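(* Let $W_1=x_0^2+f_1(x_1,\dots,x_n)$ and $W_2=y_0^2+f_2(y_1,\dots,y_m)$ be invertible polynomials in disjoint sets of variables, each satisfying the Calabi--Yau condition, let $W=W_1+W_2$, and let $G$ be a group with $J_{W_1}\times J_{W_2}\subseteq G\subseteq \mathrm{SL}_{W_1}\times \mathrm{SL}_{W_2}$. Let $\Sigma G$ be the group generated by $G$ and the involution $\sigma:(x_0,y_0)\mapsto(-x_0,-y_0)$, let $W_{tw}=f_1-f_2$, and let $G_{tw}$ be the group of those $(\alpha,\beta)\in G_{W_{tw}}^{max}$ such that $(0,\alpha,0,\beta)\in\Sigma G$. Then there is an isomorphism of vector spaces $$tw_A:\mathscr{A}_{W,\Sigma G}\to\mathscr{A}_{W_{tw},G_{tw}}$$ which preserves bi-degrees.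
   Context: Polynomials and groups. A polynomial $W\in\mathbb{C}[z_1,\dots,z_N]$ is quasihomogeneous if there are positive rational weights $q_j=w_j/d$ (with $\gcd(w_1,\dots,w_N)=1$) such that every monomial of $W$ has weighted degree $1$. It is nondegenerate if it has an isolated singularity at the origin and the weights $q_j$ are uniquely determined; it is invertible if moreover the number of monomials equals the number of variables. $G_W^{max}$ is the group of $g=(g_1,\dots,g_N)\in(\mathbb{Q}/\mathbb{Z})^N$ with $W(e^{2\pi i g_1}z_1,\dots,e^{2\pi i g_N}z_N)=W(z_1,\dots,z_N)$; it acts on $\mathbb{C}^N$ diagonally. The exponential grading operator is $\mathfrak{j}_W=(q_1,\dots,q_N)\in G_W^{max}$ and $J_W=\langle\mathfrak{j}_W\rangle$. With representatives $0\le g_j<1$, $\mathrm{age}\,g=\sum_j g_j$, and $\mathrm{SL}_W=\{g\in G_W^{max}:\mathrm{age}\,g\in\mathbb{Z}\}$. The Calabi--Yau condition for $W$ is $\sum_j q_j=1$. Twist. $\sigma=(1/2,0,\dots,0,1/2,0,\dots,0)$ with entries $1/2$ in the positions of $x_0$ and $y_0$. The polynomial $W_{tw}=f_1-f_2$ in the variables $x_1,\dots,x_n,y_1,\dots,y_m$ is invertible and quasihomogeneous, with the same weights $q$ for these variables as in $W$. An element of $G_{W_{tw}}^{max}$ is written $(\alpha,\beta)$ with $\alpha$ acting on $x_1,\dots,x_n$ and $\beta$ on $y_1,\dots,y_m$; $(0,\alpha,0,\beta)\in G_W^{max}$ acts trivially on $x_0,y_0$. State space. For $g\in G_W^{max}$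 let $\mathrm{Fix}(g)\subseteq\mathbb{C}^N$ be its fixed locus, $N_g=\dim\mathrm{Fix}(g)$, $I_g$ the set of indices of fixed variables, $W_g=W|_{\mathrm{Fix}(g)}$, $\mathscr{Q}_g=\mathbb{C}[z_i:i\in I_g]/(\partial W_g/\partial z_i)$ (equal to $\mathbb{C}$ if $I_g=\emptyset$), and $\omega_g=\bigwedge_{i\in I_g}dz_i$. $h\in G_W^{max}$ multiplies $\prod_{i\in I_g} z_i^{a_i}\,\omega_g$ by $\exp(2\pi i\sum_{i\in I_g}(a_i+1)h_i)$. For a group $H$ with $J_W\subseteq H\subseteq G_W^{max}$, the A-model (FJRW) state space is $\mathscr{A}_{W,H}=\bigoplus_{g\in H}(\mathscr{Q}_g\omega_g)^H$. It has a basis of elements $\lceil m;g\rfloor$ with $m=\prod_{i\in I_g}z_i^{a_i}\,\omega_g$; with $\deg m=\sum_{i\in I_g}(a_i+1)q_i$, the bi-degree of $\lceil m;g\rfloor$ is $(\deg m+\mathrm{age}\,g-\mathrm{age}\,\mathfrak{j}_W,\ N_g-\deg m+\mathrm{age}\,g-\mathrm{age}\,\mathfrak{j}_W)$. *)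

theory Defs
  imports
    "HOL-Library.Poly_Mapping"
    "HOL-Library.Function_Algebras"
    "HOL-Analysis.Function_Topology"
    "HOL-Analysis.Isolated"
    "HOL-Algebra.Module"
    "HOL-Algebra.QuotRing"
    "HOL-Algebra.Generated_Groups"
begin

subsection \<open>Polynomials over the complex numbers\<close>

text \<open>A monomial is its finitely supported exponent vector. The type provides arbitrarily many
  variables; the polynomial ring in a given finite set \<open>I\<close> of variables is \<open>poly_ring I\<close>, and all
  notions below take this set of variables as an explicit argument.\<close>

type_synonym 'v mon = "'v \<Rightarrow>\<^sub>0 nat"
type_synonym 'v mpoly = "'v mon \<Rightarrow>\<^sub>0 complex"

definition monomial :: "'v mon \<Rightarrow> 'v mpoly" where
  "monomial a = Poly_Mapping.single a 1"

definition Var :: "'v \<Rightarrow> 'v mpoly" where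
  "Var i = monomial (Poly_Mapping.single i 1)"

definition Const :: "complex \<Rightarrow> 'v mpoly" where
  "Const c = Poly_Mapping.single 0 c"

definition poly_ring :: "'v set \<Rightarrow> 'v mpoly ring" where
  "poly_ring I =
    \<lparr>carrier = {p. \<forall>a\<in>Poly_Mapping.keys p. Poly_Mapping.keys a \<subseteq> I},
     mult = (*), one = 1, zero = 0, add = (+)\<rparr>"

lemma poly_ring_cring: "cring (poly_ring I)"
proof (rule cringI)
  have k: "Poly_Mapping.keys (a + b) \<subseteq> I" if "Poly_Mapping.keys a \<subseteq> I" "Poly_Mapping.keys b \<subseteq> I"
    for a b :: "'a mon" using that Poly_Mapping.keys_add[of a b] by blast
  show "abelian_group (poly_ring I)"
  proof (rule abelian_groupI)
    fix x y assume "x \<in> carrier (poly_ring I)" "y \<in> carrier (poly_ring I)"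
    thus "x \<oplus>\<^bsub>poly_ring I\<^esub> y \<in> carrier (poly_ring I)"
      using Poly_Mapping.keys_add[of x y] by (fastforce simp: poly_ring_def)
  next
    fix x assume "x \<in> carrier (poly_ring I)"
    thus "\<exists>y\<in>carrier (poly_ring I). y \<oplus>\<^bsub>poly_ring I\<^esub> x = \<zero>\<^bsub>poly_ring I\<^esub>"
      by (intro bexI[of _ "-x"]) (auto simp: poly_ring_def)
  qed (auto simp: poly_ring_def algebra_simps)
  show "Group.comm_monoid (poly_ring I)"
  proof (rule comm_monoidI)
    fix x y assume xy: "x \<in> carrier (poly_ring I)" "y \<in> carrier (poly_ring I)"
    show "x \<otimes>\<^bsub>poly_ring I\<^esub> y \<in> carrier (poly_ring I)"
    proof -
      have "Poly_Mapping.keys c \<subseteq> I" if c: "c \<in> Poly_Mapping.keys (x * y)" for c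
      proof -
        obtain a b where "c = a + b" "a \<in> Poly_Mapping.keys x" "b \<in> Poly_Mapping.keys y"
          using c Poly_Mapping.keys_mult[of x y] by fast
        thus ?thesis using k[of a b] xy by (simp add: poly_ring_def)
      qed
      thus ?thesis by (simp add: poly_ring_def)
    qed
  qed (auto simp: poly_ring_def algebra_simps)
qed (auto simp: poly_ring_def algebra_simps)

definition eval :: "'v mpoly \<Rightarrow> ('v \<Rightarrow> complex) \<Rightarrow> complex" where
  "eval p z = (\<Sum>a\<in>Poly_Mapping.keys p.
     Poly_Mapping.lookup p a * (\<Prod>i\<in>Poly_Mapping.keys a. z i ^ Poly_Mapping.lookup a i))"

definition pdiff :: "'v \<Rightarrow> 'v mpoly \<Rightarrow> 'v mpoly" where
  "pdiff i p = (\<Sum>a\<in>Poly_Mapping.keys p.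
     Poly_Mapping.single (a - Poly_Mapping.single i 1)
       (of_nat (Poly_Mapping.lookup a i) * Poly_Mapping.lookup p a))"

text \<open>Restriction to the coordinate subspace where all variables outside \<open>S\<close> vanish.\<close>

definition restrict_poly :: "'v set \<Rightarrow> 'v mpoly \<Rightarrow> 'v mpoly" where
  "restrict_poly S p =
    Poly_Mapping.mapp (\<lambda>a c. if Poly_Mapping.keys a \<subseteq> S then c else 0) p"


subsection \<open>Quasihomogeneous, nondegenerate and invertible polynomials\<close>

text \<open>Points of \<open>\<complex>\<^sup>N\<close>, weight vectors and group elements are functions on the type of all variables
  that vanish outside \<open>I\<close>. Any positive rational weights giving every monomial of
  a nonzero polynomial weighted degree 1 can be written as \<open>w\<^sub>j / d\<close> with
  \<open>gcd (w\<^sub>1, \<dots>, w\<^sub>N) = 1\<close>, so that normalisation is no condition on the \<open>q\<^sub>j\<close>.\<close>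

definition affine_space :: "'v set \<Rightarrow> ('v \<Rightarrow> complex) set" where
  "affine_space I = {z. \<forall>i. i \<notin> I \<longrightarrow> z i = 0}"

definition weight_system :: "'v set \<Rightarrow> 'v mpoly \<Rightarrow> ('v \<Rightarrow> rat) \<Rightarrow> bool" where
  "weight_system I W q \<longleftrightarrow>
    (\<forall>i\<in>I. q i > 0) \<and> (\<forall>i. i \<notin> I \<longrightarrow> q i = 0) \<and>
    (\<forall>a\<in>Poly_Mapping.keys W. (\<Sum>i\<in>I. of_nat (Poly_Mapping.lookup a i) * q i) = 1)"

definition quasihomogeneous :: "'v set \<Rightarrow> 'v mpoly \<Rightarrow> bool" where
  "quasihomogeneous I W \<longleftrightarrow> W \<in> carrier (poly_ring I) \<and> (\<exists>q. weight_system I W q)"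

definition critical_points :: "'v set \<Rightarrow> 'v mpoly \<Rightarrow> ('v \<Rightarrow> complex) set" where
  "critical_points I W = {z \<in> affine_space I. \<forall>i\<in>I. eval (pdiff i W) z = 0}"

text \<open>The topology on \<open>'v \<Rightarrow> complex\<close> is the product topology, which induces the usual topology on
  \<open>affine_space I\<close>.\<close>

definition nondegenerate :: "'v set \<Rightarrow> 'v mpoly \<Rightarrow> bool" where
  "nondegenerate I W \<longleftrightarrow>
    quasihomogeneous I W \<and> (\<lambda>_. 0) isolated_in critical_points I W \<and>
    (\<exists>!q. weight_system I W q)"

definition invertible_poly :: "'v set \<Rightarrow> 'v mpoly \<Rightarrow> bool" where
  "invertible_poly I W \<longleftrightarrow>
    finite I \<and> nondegenerate I W \<and> card (Poly_Mapping.keys W) = card I"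

definition weights :: "'v set \<Rightarrow> 'v mpoly \<Rightarrow> 'v \<Rightarrow> rat" where
  "weights I W = (THE q. weight_system I W q)"

definition calabi_yau :: "'v set \<Rightarrow> 'v mpoly \<Rightarrow> bool" where
  "calabi_yau I W \<longleftrightarrow> (\<Sum>i\<in>I. weights I W i) = 1"


subsection \<open>Symmetry groups\<close>

text \<open>\<open>QZ I\<close> is the group \<open>(\<rat>/\<int>)\<^sup>N\<close>, every class being given by its representative in
  \<open>[0,1)\<close>. Because elements are extended by 0 outside \<open>I\<close>, \<open>QZ I\<^sub>0\<close> is literally a subgroup of \<open>QZ I\<close>
  for \<open>I\<^sub>0 \<subseteq> I\<close>, and for subgroups \<open>A\<close> of \<open>QZ I\<^sub>1\<close> and \<open>B\<close> of \<open>QZ I\<^sub>2\<close>, with \<open>I\<^sub>1\<close>, \<open>I\<^sub>2\<close> disjoint,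
  the product \<open>A \<times> B\<close> is \<open>A <#> B\<close>.\<close>

definition QZ :: "'v set \<Rightarrow> ('v \<Rightarrow> rat) monoid" where
  "QZ I =
    \<lparr>carrier = {g. (\<forall>i\<in>I. 0 \<le> g i \<and> g i < 1) \<and> (\<forall>i. i \<notin> I \<longrightarrow> g i = 0)},
     mult = (\<lambda>g h i. frac (g i + h i)), one = (\<lambda>_. 0)\<rparr>"

lemma QZ_comm_group: "comm_group (QZ I)"
proof (rule comm_groupI)
  fix x assume x: "x \<in> carrier (QZ I)"
  define y where "y = (\<lambda>i. frac (- x i))"
  have "y \<in> carrier (QZ I)" using x by (auto simp: QZ_def y_def frac_lt_1)
  moreover have "y \<otimes>\<^bsub>QZ I\<^esub> x = \<one>\<^bsub>QZ I\<^esub>"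
    by (auto simp: QZ_def y_def frac_def fun_eq_iff)
  ultimately show "\<exists>y\<in>carrier (QZ I). y \<otimes>\<^bsub>QZ I\<^esub> x = \<one>\<^bsub>QZ I\<^esub>" by blast
next
  fix x y z show "x \<otimes>\<^bsub>QZ I\<^esub> y \<otimes>\<^bsub>QZ I\<^esub> z = x \<otimes>\<^bsub>QZ I\<^esub> (y \<otimes>\<^bsub>QZ I\<^esub> z)"
  proof -
    have "frac (frac (x i + y i) + z i) = frac (x i + frac (y i + z i))" for i
      by (simp add: frac_def algebra_simps)
    thus ?thesis by (simp add: QZ_def)
  qed
next
  fix x assume x: "x \<in> carrier (QZ I)"
  have "frac (x i) = x i" for i
    using x by (cases "i \<in> I") (auto simp: QZ_def frac_eq)
  then show "\<one>\<^bsub>QZ I\<^esub> \<otimes>\<^bsub>QZ I\<^esub> x = x"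
    by (simp add: QZ_def)
qed (auto simp: QZ_def frac_lt_1 add.commute)

definition e2pi :: "rat \<Rightarrow> complex" where
  "e2pi x = exp (2 * of_real pi * \<i> * of_rat x)"

definition Gmax :: "'v set \<Rightarrow> 'v mpoly \<Rightarrow> ('v \<Rightarrow> rat) set" where
  "Gmax I W = {g \<in> carrier (QZ I). \<forall>z. eval W (\<lambda>i. e2pi (g i) * z i) = eval W z}"

definition grading_op :: "'v set \<Rightarrow> 'v mpoly \<Rightarrow> 'v \<Rightarrow> rat" where
  "grading_op I W = (\<lambda>i. frac (weights I W i))"

definition Jgroup :: "'v set \<Rightarrow> 'v mpoly \<Rightarrow> ('v \<Rightarrow> rat) set" where
  "Jgroup I W = generate (QZ I) {grading_op I W}"

definition age :: "'v set \<Rightarrow> ('v \<Rightarrow> rat) \<Rightarrow> rat" where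
  "age I g = (\<Sum>i\<in>I. g i)"

definition SL :: "'v set \<Rightarrow> 'v mpoly \<Rightarrow> ('v \<Rightarrow> rat) set" where
  "SL I W = {g \<in> Gmax I W. age I g \<in> \<int>}"


subsection \<open>The A-model state space\<close>

definition Fix :: "'v set \<Rightarrow> ('v \<Rightarrow> rat) \<Rightarrow> ('v \<Rightarrow> complex) set" where
  "Fix I g = {z \<in> affine_space I. \<forall>i\<in>I. e2pi (g i) * z i = z i}"

definition fixed_dim :: "'v set \<Rightarrow> ('v \<Rightarrow> rat) \<Rightarrow> nat" where
  "fixed_dim I g = vector_space.dim (\<lambda>(c::complex) z i. c * z i) (Fix I g)"

definition fixed_vars :: "'v set \<Rightarrow> ('v \<Rightarrow> rat) \<Rightarrow> 'v set" where
  "fixed_vars I g = {i \<in> I. g i = 0}"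

definition jacobian_ideal :: "'v set \<Rightarrow> 'v mpoly \<Rightarrow> ('v \<Rightarrow> rat) \<Rightarrow> 'v mpoly set" where
  "jacobian_ideal I W g =
    Idl\<^bsub>poly_ring (fixed_vars I g)\<^esub>
      ((\<lambda>i. pdiff i (restrict_poly (fixed_vars I g) W)) ` fixed_vars I g)"

definition jacobian_ring :: "'v set \<Rightarrow> 'v mpoly \<Rightarrow> ('v \<Rightarrow> rat) \<Rightarrow> 'v mpoly set ring" where
  "jacobian_ring I W g = poly_ring (fixed_vars I g) Quot jacobian_ideal I W g"

definition jacobian_class :: "'v set \<Rightarrow> 'v mpoly \<Rightarrow> ('v \<Rightarrow> rat) \<Rightarrow> 'v mpoly \<Rightarrow> 'v mpoly set" where
  "jacobian_class I W g p = jacobian_ideal I W g +>\<^bsub>poly_ring (fixed_vars I g)\<^esub> p"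

text \<open>The factor \<open>\<omega>\<^sub>g\<close> is left implicit: a class \<open>C\<close> in \<open>jacobian_ring I W g\<close> stands for \<open>C \<omega>\<^sub>g\<close>.
  It contributes the \<open>+ 1\<close> in the action, which sends a class to its image.\<close>

definition form_action :: "'v set \<Rightarrow> ('v \<Rightarrow> rat) \<Rightarrow> 'v mpoly \<Rightarrow> 'v mpoly" where
  "form_action S h p =
    Poly_Mapping.mapp
      (\<lambda>a c. e2pi (\<Sum>i\<in>S. (of_nat (Poly_Mapping.lookup a i) + 1) * h i) * c) p"

definition invariant_sector ::
    "'v set \<Rightarrow> 'v mpoly \<Rightarrow> ('v \<Rightarrow> rat) set \<Rightarrow> ('v \<Rightarrow> rat) \<Rightarrow> 'v mpoly set set" where
  "invariant_sector I W H g =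
    {C \<in> carrier (jacobian_ring I W g). \<forall>h\<in>H. form_action (fixed_vars I g) h ` C = C}"

definition complex_ring :: "complex ring" where
  "complex_ring = \<lparr>carrier = UNIV, mult = (*), one = 1, zero = 0, add = (+)\<rparr>"

text \<open>Only the vector space structure of the state space is used, so the ring multiplication and
  unit that the record type \<open>module\<close> carries are left unspecified.\<close>

definition state_space ::
    "'v set \<Rightarrow> 'v mpoly \<Rightarrow> ('v \<Rightarrow> rat) set \<Rightarrow> (complex, ('v \<Rightarrow> rat) \<Rightarrow> 'v mpoly set) module" where
  "state_space I W H =
    \<lparr>carrier = {s \<in> Pi\<^sub>E H (invariant_sector I W H).
                 finite {g \<in> H. s g \<noteq> \<zero>\<^bsub>jacobian_ring I W g\<^esub>}},
     mult = undefined, one = undefined,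
     zero = (\<lambda>g\<in>H. \<zero>\<^bsub>jacobian_ring I W g\<^esub>),
     add = (\<lambda>s t. \<lambda>g\<in>H. s g \<oplus>\<^bsub>jacobian_ring I W g\<^esub> t g),
     smult = (\<lambda>c s. \<lambda>g\<in>H. jacobian_class I W g (Const c) \<otimes>\<^bsub>jacobian_ring I W g\<^esub> s g)\<rparr>"

text \<open>The element \<open>\<lceil>m; g\<rfloor>\<close> for \<open>m = z\<^sup>a \<omega>\<^sub>g\<close>.\<close>

definition sector_element ::
    "'v set \<Rightarrow> 'v mpoly \<Rightarrow> ('v \<Rightarrow> rat) set \<Rightarrow> 'v mon \<Rightarrow> ('v \<Rightarrow> rat) \<Rightarrow> (('v \<Rightarrow> rat) \<Rightarrow> 'v mpoly set)" where
  "sector_element I W H a g =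
    (\<lambda>g'\<in>H. if g' = g then jacobian_class I W g (monomial a) else \<zero>\<^bsub>jacobian_ring I W g'\<^esub>)"

definition form_deg :: "'v set \<Rightarrow> 'v mpoly \<Rightarrow> 'v mon \<Rightarrow> ('v \<Rightarrow> rat) \<Rightarrow> rat" where
  "form_deg I W a g =
    (\<Sum>i\<in>fixed_vars I g. (of_nat (Poly_Mapping.lookup a i) + 1) * weights I W i)"

definition bidegree :: "'v set \<Rightarrow> 'v mpoly \<Rightarrow> 'v mon \<Rightarrow> ('v \<Rightarrow> rat) \<Rightarrow> rat \<times> rat" where
  "bidegree I W a g =
    (form_deg I W a g + age I g - age I (grading_op I W),
     of_nat (fixed_dim I g) - form_deg I W a g + age I g - age I (grading_op I W))"

definition module_span :: "('a, 'c) ring_scheme \<Rightarrow> ('a, 'b) module \<Rightarrow> 'b set \<Rightarrow> 'b set" where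
  "module_span R M S = \<Inter>{N. submodule N R M \<and> S \<subseteq> N}"

definition bidegree_part ::
    "'v set \<Rightarrow> 'v mpoly \<Rightarrow> ('v \<Rightarrow> rat) set \<Rightarrow> rat \<times> rat \<Rightarrow> (('v \<Rightarrow> rat) \<Rightarrow> 'v mpoly set) set" where
  "bidegree_part I W H d =
    module_span complex_ring (state_space I W H)
      {sector_element I W H a g | a g.
         g \<in> H \<and> Poly_Mapping.keys a \<subseteq> fixed_vars I g \<and>
         sector_element I W H a g \<in> carrier (state_space I W H) \<and> bidegree I W a g = d}"

definition module_iso ::
    "('a, 'd) ring_scheme \<Rightarrow> ('a, 'b) module \<Rightarrow> ('a, 'c) module \<Rightarrow> ('b \<Rightarrow> 'c) set" where
  "module_iso R M N =
    {f. bij_betw f (carrier M) (carrier N) \<and>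
        (\<forall>x\<in>carrier M. \<forall>y\<in>carrier M. f (x \<oplus>\<^bsub>M\<^esub> y) = f x \<oplus>\<^bsub>N\<^esub> f y) \<and>
        (\<forall>c\<in>carrier R. \<forall>x\<in>carrier M. f (c \<odot>\<^bsub>M\<^esub> x) = c \<odot>\<^bsub>N\<^esub> f x)}"


subsection \<open>Variables and groups of the twist\<close>

datatype var = X nat | Y nat

definition twist_involution :: "var \<Rightarrow> rat" where
  "twist_involution = (\<lambda>i. if i = X 0 \<or> i = Y 0 then 1/2 else 0)"

definition Sigma_group :: "var set \<Rightarrow> (var \<Rightarrow> rat) set \<Rightarrow> (var \<Rightarrow> rat) set" where
  "Sigma_group I G = generate (QZ I) (insert twist_involution G)"

text \<open>Since group elements are extended by 0, the element \<open>(0, \<alpha>, 0, \<beta>)\<close> is \<open>(\<alpha>, \<beta>)\<close> itself.\<close>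

definition twist_group :: "var set \<Rightarrow> var mpoly \<Rightarrow> (var \<Rightarrow> rat) set \<Rightarrow> (var \<Rightarrow> rat) set" where
  "twist_group I_tw W_tw SG = {g \<in> Gmax I_tw W_tw. g \<in> SG}"

end

theory Submission
  imports "HOL-Analysis.Complex_Transcendental" Defs
begin

text \<open>Killing \<open>x\<^sub>0\<close> and \<open>y\<^sub>0\<close> identifies the Jacobian ring of every sector \<open>g\<close> of \<open>W\<close> with the one of
  \<open>W_tw\<close> for the restriction of \<open>g\<close> to the remaining variables; the missing \<open>dx\<^sub>0\<close> and \<open>dy\<^sub>0\<close> only
  contribute a character to the group action. If \<open>g\<close> fixes exactly one of \<open>x\<^sub>0\<close>, \<open>y\<^sub>0\<close>, then \<open>\<sigma>\<close> acts
  on its sector by \<open>-1\<close> and nothing is invariant. All other elements of \<open>\<Sigma>G\<close> are \<open>k\<close> or \<open>\<sigma>k\<close>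
  with \<open>k \<in> G_tw\<close>. Since \<open>\<Sigma>G\<close> is generated by \<open>G_tw\<close>, \<open>\<sigma>\<close> and the grading operator \<open>j\<close> of \<open>W\<^sub>1\<close>, and
  \<open>j\<^sup>2 \<in> G_tw\<close>, the operator \<open>j\<close> is an involution on the \<open>G_tw\<close>-invariants of the sector \<open>k\<close>
  of \<open>W_tw\<close>. The sectors \<open>k\<close> and \<open>\<sigma>k\<close> of \<open>W\<close> are its eigenspaces for \<open>-1\<close> and \<open>1\<close>, because \<open>j\<close> acts
  on \<open>dx\<^sub>0 \<and> dy\<^sub>0\<close> by \<open>-1\<close>. Hence \<open>tw_A\<close> adds the components of \<open>k\<close> and \<open>\<sigma>k\<close>.\<close>

subsection \<open>Polynomials and diagonal symmetries\<close>

text \<open>A bi-degree is attached to a monomial, not to its class, and a bi-degree part is the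
  span of the invariant classes of monomials of that bi-degree. So bijectivity and linearity are not
  enough: generators have to be matched in both directions. Monomials are eigenvectors of every
  diagonal symmetry, in particular of \<open>j\<close>; hence an invariant monomial class of
  \<open>W_tw\<close> is never split between the two eigenspaces and again has a monomial as
  preimage. The match holds only up to 0, because a generator of \<open>W\<close> whose monomial
  contains \<open>X 0\<close> or \<open>Y 0\<close>, or whose sector fixes just one of them,
  vanishes whatever bi-degree it carries. The minus sign in \<open>f1 - f2\<close> only changes the
  sign of the derivatives by the \<open>Y\<close> variables, so it leaves the Jacobian ideals alone.
  Symmetries are defined through values of \<open>W\<close> at points but used through exponents of
  monomials; linear independence of the monomials as functions links the two.\<close>

abbreviation coeff :: "('a \<Rightarrow>\<^sub>0 'b::zero) \<Rightarrow> 'a \<Rightarrow> 'b" where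
  "coeff \<equiv> Poly_Mapping.lookup"

abbreviation keys :: "('a \<Rightarrow>\<^sub>0 'b::zero) \<Rightarrow> 'a set" where
  "keys \<equiv> Poly_Mapping.keys"

text \<open>Exponents are natural numbers, so no cancellation can shrink the support.\<close>

lemma keys_add_nat: "keys (a + b :: 'v mon) = keys a \<union> keys b"
  by (auto simp: in_keys_iff lookup_add)

lemma coeff_restrict_poly:
  "coeff (restrict_poly S p) a = (if keys a \<subseteq> S then coeff p a else 0)"
  by (simp add: restrict_poly_def lookup_mapp when_def in_keys_iff)

lemma coeff_form_action:
  "coeff (form_action S h p) a = e2pi (\<Sum>i\<in>S. (of_nat (coeff a i) + 1) * h i) * coeff p a"
  by (simp add: form_action_def lookup_mapp when_def in_keys_iff)

text \<open>\<open>pdiff\<close> lowers exponents by truncated subtraction. A monomial without the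
  variable \<open>i\<close> is therefore not lowered at all, but then its coefficient carries the
  factor 0, and shifting the index upwards is exact.\<close>

lemma coeff_pdiff:
  "coeff (pdiff i p) a = of_nat (coeff a i + 1) * coeff p (a + Poly_Mapping.single i 1)"
proof -
  let ?e = "Poly_Mapping.single i (1::nat)"
  have *: "coeff (Poly_Mapping.single (b - ?e) (of_nat (coeff b i) * coeff p b)) a
      = (if b = a + ?e then of_nat (coeff b i) * coeff p b else 0)" for b
  proof (cases "coeff b i = 0")
    case False
    then have "b - ?e = a \<longleftrightarrow> b = a + ?e"
      by (auto simp: poly_mapping_eq_iff fun_eq_iff lookup_minus lookup_add lookup_single when_def)
    then show ?thesis by (auto simp: lookup_single when_def)
  next
    case True
    then have "b \<noteq> a + ?e" by (auto simp: lookup_add)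
    with True show ?thesis by simp
  qed
  have "coeff (pdiff i p) a = (\<Sum>b\<in>keys p. if b = a + ?e then of_nat (coeff b i) * coeff p b else 0)"
    unfolding pdiff_def lookup_sum * ..
  also have "\<dots> = of_nat (coeff a i + 1) * coeff p (a + ?e)"
    by (simp add: lookup_add in_keys_iff)
  finally show ?thesis .
qed

lemma coeff_Const_mult [simp]: "coeff (Const c * p) a = c * coeff p a"
proof -
  have "Const c * p = Poly_Mapping.map ((*) c) p"
    unfolding Const_def mult_map_scale_conv_mult ..
  then show ?thesis by (simp add: Poly_Mapping.map.rep_eq when_def)
qed

lemma Const_1 [simp]: "Const 1 = 1"
  by (simp add: Const_def)

lemma Const_uminus_1 [simp]: "Const (- 1) = - 1"
  by (rule poly_mapping_eqI) (simp add: Const_def lookup_single lookup_one when_def)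

lemma carrier_poly_ring: "carrier (poly_ring I) = {p. \<forall>a\<in>keys p. keys a \<subseteq> I}"
  by (simp add: poly_ring_def)

lemma poly_ring_simps [simp]:
  "monoid.mult (poly_ring I) = (*)" "one (poly_ring I) = 1" "zero (poly_ring I) = 0"
  "add (poly_ring I) = (+)"
  by (simp_all add: poly_ring_def)

lemma in_poly_ring_iff: "p \<in> carrier (poly_ring I) \<longleftrightarrow> (\<forall>a. coeff p a \<noteq> 0 \<longrightarrow> keys a \<subseteq> I)"
  by (auto simp: carrier_poly_ring in_keys_iff)

lemma poly_ring_0 [simp]: "0 \<in> carrier (poly_ring I)"
  by (simp add: in_poly_ring_iff)

lemma poly_ring_add [intro]:
  "p \<in> carrier (poly_ring I) \<Longrightarrow> q \<in> carrier (poly_ring I) \<Longrightarrow> p + q \<in> carrier (poly_ring I)"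
  unfolding in_poly_ring_iff lookup_add by (metis add.right_neutral)

lemma poly_ring_diff [intro]:
  "p \<in> carrier (poly_ring I) \<Longrightarrow> q \<in> carrier (poly_ring I) \<Longrightarrow> p - q \<in> carrier (poly_ring I)"
  unfolding in_poly_ring_iff lookup_minus by (metis diff_0_right)

lemma poly_ring_uminus [intro]: "p \<in> carrier (poly_ring I) \<Longrightarrow> - p \<in> carrier (poly_ring I)"
  by (simp add: in_poly_ring_iff)

lemma poly_ring_mult [intro]:
  "p \<in> carrier (poly_ring I) \<Longrightarrow> q \<in> carrier (poly_ring I) \<Longrightarrow> p * q \<in> carrier (poly_ring I)"
  using monoid.m_closed[OF ring.axioms(2)[OF cring.axioms(1)[OF poly_ring_cring]], of p I q]
  by simp

lemma poly_ring_Const [intro]: "Const c \<in> carrier (poly_ring I)"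
  by (auto simp: in_poly_ring_iff Const_def lookup_single when_def)

lemma poly_ring_mono: "S \<subseteq> T \<Longrightarrow> p \<in> carrier (poly_ring S) \<Longrightarrow> p \<in> carrier (poly_ring T)"
  by (auto simp: in_poly_ring_iff)

lemma poly_ring_monomial_iff [simp]: "monomial a \<in> carrier (poly_ring I) \<longleftrightarrow> keys a \<subseteq> I"
  by (auto simp: in_poly_ring_iff monomial_def lookup_single when_def)

lemma poly_ring_restrict [intro]: "restrict_poly S p \<in> carrier (poly_ring S)"
  by (simp add: in_poly_ring_iff coeff_restrict_poly)

lemma poly_ring_form_action [intro]:
  "p \<in> carrier (poly_ring I) \<Longrightarrow> form_action S h p \<in> carrier (poly_ring I)"
  by (simp add: in_poly_ring_iff coeff_form_action)

lemma poly_ring_pdiff_restrict [intro]: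
  "pdiff i (restrict_poly S p) \<in> carrier (poly_ring S)"
  by (simp add: in_poly_ring_iff coeff_pdiff coeff_restrict_poly keys_add_nat)

lemma restrict_poly_ident: "p \<in> carrier (poly_ring S) \<Longrightarrow> restrict_poly S p = p"
  by (rule poly_mapping_eqI) (auto simp: coeff_restrict_poly in_poly_ring_iff)

lemma restrict_poly_add: "restrict_poly S (p + q) = restrict_poly S p + restrict_poly S q"
  by (rule poly_mapping_eqI) (simp add: coeff_restrict_poly lookup_add)

lemma restrict_poly_Const_mult: "restrict_poly S (Const c * p) = Const c * restrict_poly S p"
  by (rule poly_mapping_eqI) (simp add: coeff_restrict_poly)

lemma form_action_add: "form_action S h (p + q) = form_action S h p + form_action S h q"
  by (rule poly_mapping_eqI) (simp add: coeff_form_action lookup_add algebra_simps)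

lemma form_action_diff: "form_action S h (p - q) = form_action S h p - form_action S h q"
  by (rule poly_mapping_eqI) (simp add: coeff_form_action lookup_minus algebra_simps)

lemma form_action_Const_mult: "form_action S h (Const c * p) = Const c * form_action S h p"
  by (rule poly_mapping_eqI) (simp add: coeff_form_action)

lemma form_action_monomial:
  "form_action S h (monomial a) = Const (e2pi (\<Sum>i\<in>S. (of_nat (coeff a i) + 1) * h i)) * monomial a"
  by (rule poly_mapping_eqI) (simp add: coeff_form_action monomial_def lookup_single when_def)

text \<open>Common form of \<open>form_action\<close> and \<open>restrict_poly\<close>: both
  multiply the coefficient at \<open>a\<close> by a number that depends on \<open>a\<close>
  alone.\<close>

definition rescale :: "('v mon \<Rightarrow> complex) \<Rightarrow> 'v mpoly \<Rightarrow> 'v mpoly" where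
  "rescale \<mu> p = Poly_Mapping.mapp (\<lambda>a c. \<mu> a * c) p"

lemma coeff_rescale [simp]: "coeff (rescale \<mu> p) a = \<mu> a * coeff p a"
  by (simp add: rescale_def lookup_mapp when_def in_keys_iff)

lemma poly_eq_sum_single: "p = (\<Sum>a\<in>keys p. Poly_Mapping.single a (coeff p a))"
  for p :: "'a \<Rightarrow>\<^sub>0 'b::comm_monoid_add"
  by (rule poly_mapping_eqI) (simp add: lookup_sum lookup_single when_def in_keys_iff)

lemma rescale_sum: "rescale \<mu> (sum f A) = (\<Sum>x\<in>A. rescale \<mu> (f x))"
  by (rule poly_mapping_eqI) (simp add: lookup_sum sum_distrib_left)

lemma rescale_single: "rescale \<mu> (Poly_Mapping.single a c) = Poly_Mapping.single a (\<mu> a * c)"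
  by (rule poly_mapping_eqI) (simp add: lookup_single when_def)

text \<open>Three multipliers instead of one character: in a product of a function and a form, the
  factor coming from the volume form belongs to the form only.\<close>

lemma rescale_mult:
  assumes "\<And>a b. \<nu> (a + b) = \<kappa> a * \<mu> b"
  shows "rescale \<nu> (p * q) = rescale \<kappa> p * rescale \<mu> q"
proof -
  let ?s = "Poly_Mapping.single"
  have *: "rescale \<mu> p = (\<Sum>a\<in>keys p. ?s a (\<mu> a * coeff p a))" for \<mu> and p :: "'a mpoly"
    by (subst poly_eq_sum_single) (simp add: rescale_sum rescale_single)
  have "p * q = (\<Sum>a\<in>keys p. \<Sum>b\<in>keys q. ?s (a + b) (coeff p a * coeff q b))"
  proof -
    have "p * q = (\<Sum>a\<in>keys p. ?s a (coeff p a)) * (\<Sum>b\<in>keys q. ?s b (coeff q b))"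
      by (rule arg_cong2[where f = "(*)"]) (rule poly_eq_sum_single)+
    then show ?thesis by (simp add: sum_product mult_single)
  qed
  then have "rescale \<nu> (p * q)
      = (\<Sum>a\<in>keys p. \<Sum>b\<in>keys q. ?s a (\<kappa> a * coeff p a) * ?s b (\<mu> b * coeff q b))"
    by (simp add: rescale_sum rescale_single assms mult_single ac_simps)
  also have "\<dots> = rescale \<kappa> p * rescale \<mu> q"
    by (simp add: * sum_product)
  finally show ?thesis .
qed

text \<open>The indicator of the monomials supported in \<open>S\<close> is multiplicative, since
  supports unite in a product.\<close>

lemma restrict_poly_mult: "restrict_poly S (p * q) = restrict_poly S p * restrict_poly S q"
proof -
  have *: "restrict_poly S p = rescale (\<lambda>a. of_bool (keys a \<subseteq> S)) p" for p
    by (rule poly_mapping_eqI) (simp add: coeff_restrict_poly)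
  show ?thesis unfolding * by (rule rescale_mult) (simp add: keys_add_nat)
qed

lemma restrict_poly_Var: "i \<notin> S \<Longrightarrow> restrict_poly S (Var i) = 0"
  by (rule poly_mapping_eqI) (auto simp: coeff_restrict_poly Var_def monomial_def lookup_single when_def)

section \<open>Phases of monomials and the maximal symmetry group\<close>

lemma e2pi_add: "e2pi (x + y) = e2pi x * e2pi y"
  by (simp add: e2pi_def of_rat_add distrib_left exp_add)

lemma e2pi_0 [simp]: "e2pi 0 = 1"
  by (simp add: e2pi_def)

lemma e2pi_sum: "e2pi (sum f A) = (\<Prod>x\<in>A. e2pi (f x))"
  by (induction A rule: infinite_finite_induct) (auto simp: e2pi_add)

lemma e2pi_of_nat_mult: "e2pi (of_nat k * x) = e2pi x ^ k"
  by (induction k) (auto simp: e2pi_add algebra_simps)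

lemma e2pi_eq_1_iff: "e2pi x = 1 \<longleftrightarrow> x \<in> \<int>"
proof -
  have "complex_of_rat x = complex_of_real (real_of_rat x)"
    by (cases x) (simp add: of_rat_rat)
  then have "2 * of_real pi * \<i> * of_rat x = complex_of_real (2 * (pi * of_rat x)) * \<i>"
    by simp
  then have "e2pi x = 1 \<longleftrightarrow> (\<exists>k::int. 2 * (pi * of_rat x) = 2 * real_of_int k * pi)"
    unfolding e2pi_def exp_eq_1 by auto
  also have "\<dots> \<longleftrightarrow> (\<exists>k::int. (of_rat x :: real) = of_rat (of_int k))"
    by (auto simp: mult.commute)
  also have "\<dots> \<longleftrightarrow> x \<in> \<int>"
    unfolding of_rat_eq_iff by (auto simp: Ints_def)
  finally show ?thesis .
qed

lemma e2pi_half [simp]: "e2pi (1/2) = - 1"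
proof -
  have "2 * of_real pi * \<i> * of_rat (1/2) = of_real pi * \<i>" by (simp add: of_rat_divide)
  then show ?thesis unfolding e2pi_def by (simp only: exp_pi_i)
qed

lemma e2pi_eqI: "x - y \<in> \<int> \<Longrightarrow> e2pi x = e2pi y"
  using e2pi_add[of "x - y" y] by (simp add: e2pi_eq_1_iff[symmetric])

lemma e2pi_uminus: "e2pi (- x) * e2pi x = 1"
  by (metis e2pi_0 e2pi_add add.left_inverse)

text \<open>Here \<open>p\<close> stands for a form and \<open>r\<close> for a function, so
  \<open>r\<close> transforms without the \<open>+ 1\<close>. This is what carries stability of the
  Jacobian ideal from generators to multiples.\<close>

lemma form_action_mult:
  "form_action S h (r * p) = rescale (\<lambda>a. e2pi (\<Sum>i\<in>S. of_nat (coeff a i) * h i)) r * form_action S h p"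
proof -
  have *: "form_action S h p = rescale (\<lambda>a. e2pi (\<Sum>i\<in>S. (of_nat (coeff a i) + 1) * h i)) p" for p
    by (rule poly_mapping_eqI) (simp add: coeff_form_action)
  show ?thesis unfolding *
    by (rule rescale_mult) (simp add: lookup_add sum.distrib algebra_simps flip: e2pi_add)
qed

text \<open>The phase of the monomial \<open>a\<close> under the symmetry \<open>h\<close>, kept as
  a rational number rather than modulo 1; with weights in place of \<open>h\<close> it is the
  weighted degree. Summing over \<open>keys a\<close> avoids an ambient set of variables, so the
  same number serves \<open>W\<close>, \<open>W1\<close>, \<open>W2\<close> and
  \<open>W_tw\<close>.\<close>

definition pairing :: "'v mon \<Rightarrow> ('v \<Rightarrow> rat) \<Rightarrow> rat" where
  "pairing a h = (\<Sum>i\<in>keys a. of_nat (coeff a i) * h i)"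

lemma pairing_eq: "finite S \<Longrightarrow> keys a \<subseteq> S \<Longrightarrow> pairing a h = (\<Sum>i\<in>S. of_nat (coeff a i) * h i)"
  unfolding pairing_def by (rule sum.mono_neutral_left) (auto simp: in_keys_iff)

text \<open>The monomials are distinct characters of the multiplicative monoid of points, so this is
  Dedekind's argument.\<close>

lemma monomials_linearly_independent:
  assumes "finite A" and "\<And>z. (\<Sum>a\<in>A. c a * (\<Prod>i\<in>keys a. z i ^ coeff a i)) = 0" and "b \<in> A"
  shows "c b = (0::complex)"
  using assms
proof (induction A arbitrary: c b rule: finite_induct)
  case (insert b A c d)
  let ?\<chi> = "\<lambda>a z. \<Prod>i\<in>keys a. z i ^ coeff a i :: complex"
  have mult_\<chi>: "?\<chi> a (\<lambda>i. w i * z i) = ?\<chi> a w * ?\<chi> a z" for a w z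
    by (simp add: power_mult_distrib prod.distrib)
  have rest: "c a = 0" if "a \<in> A" for a
  proof -
    from that insert.hyps have "a \<noteq> b" by blast
    then obtain i where i: "coeff a i \<noteq> coeff b i"
      by (auto simp: poly_mapping_eq_iff fun_eq_iff)
    \<comment> \<open>The exponents of \<open>a\<close> and \<open>b\<close> differ at
      \<open>i\<close>, so the point with 2 in this coordinate separates the two characters: their
      values are distinct powers of 2.\<close>
    define w where "w = (\<lambda>j. if j = i then 2 else 1 :: complex)"
    have \<chi>w: "?\<chi> a w = 2 ^ coeff a i" for a
    proof -
      have "?\<chi> a w = (\<Prod>j\<in>keys a. if j = i then 2 ^ coeff a i else 1)"
        by (rule prod.cong) (auto simp: w_def)
      then show ?thesis by (simp add: in_keys_iff)
    qed
    \<comment> \<open>Translating the relation by \<open>w\<close> and subtracting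
      \<open>?\<chi> b w\<close> times the relation removes the term of \<open>b\<close> and leaves
      a relation on \<open>A\<close>.\<close>
    have "c a * (?\<chi> a w - ?\<chi> b w) = 0"
    proof (rule insert.IH[OF _ that])
      fix z
      have "(\<Sum>a\<in>insert b A. c a * (?\<chi> a w - ?\<chi> b w) * ?\<chi> a z)
          = (\<Sum>a\<in>insert b A. c a * ?\<chi> a (\<lambda>j. w j * z j)) - ?\<chi> b w * (\<Sum>a\<in>insert b A. c a * ?\<chi> a z)"
        unfolding sum_distrib_left sum_subtractf[symmetric]
        by (rule sum.cong) (simp_all only: mult_\<chi>, simp_all only: ring_distribs mult_ac)
      also have "\<dots> = 0"
        unfolding insert.prems(1) by simp
      finally show "(\<Sum>a\<in>A. c a * (?\<chi> a w - ?\<chi> b w) * ?\<chi> a z) = 0"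
        using insert.hyps by simp
    qed
    moreover have "?\<chi> a w \<noteq> ?\<chi> b w"
    proof
      assume "?\<chi> a w = ?\<chi> b w"
      then have "norm ((2::complex) ^ coeff a i) = norm ((2::complex) ^ coeff b i)"
        unfolding \<chi>w by simp
      then show False using i by (simp add: norm_power)
    qed
    ultimately show ?thesis by simp
  qed
  moreover have "c b = 0"
    using insert.prems(1)[of "\<lambda>_. 1"] insert.hyps rest by simp
  ultimately show ?case using insert.prems(2) by blast
qed simp

text \<open>The difference of the two values of \<open>W\<close> is a combination of its monomials
  with coefficients \<open>(e2pi (pairing a g) - 1) * coeff W a\<close>; by linear independence each
  of them vanishes.\<close>

lemma Gmax_iff:
  "g \<in> Gmax I W \<longleftrightarrow> g \<in> carrier (QZ I) \<and> (\<forall>a\<in>keys W. pairing a g \<in> \<int>)"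
proof -
  let ?\<chi> = "\<lambda>a z. \<Prod>i\<in>keys a. z i ^ coeff a i :: complex"
  have tw: "?\<chi> a (\<lambda>i. e2pi (g i) * z i) = e2pi (pairing a g) * ?\<chi> a z" for a z
    by (simp add: pairing_def e2pi_sum e2pi_of_nat_mult power_mult_distrib prod.distrib)
  have diff: "(\<Sum>a\<in>keys W. (e2pi (pairing a g) - 1) * coeff W a * ?\<chi> a z)
      = eval W (\<lambda>i. e2pi (g i) * z i) - eval W z" for z
    unfolding eval_def tw sum_subtractf[symmetric]
    by (rule sum.cong[OF refl]) (simp only: left_diff_distrib right_diff_distrib mult_1_left mult_ac)
  have "(\<forall>z. eval W (\<lambda>i. e2pi (g i) * z i) = eval W z)
      \<longleftrightarrow> (\<forall>z. (\<Sum>a\<in>keys W. (e2pi (pairing a g) - 1) * coeff W a * ?\<chi> a z) = 0)"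
    by (simp add: diff)
  also have "\<dots> \<longleftrightarrow> (\<forall>a\<in>keys W. (e2pi (pairing a g) - 1) * coeff W a = 0)"
  proof safe
    fix a assume z: "\<forall>z. (\<Sum>a\<in>keys W. (e2pi (pairing a g) - 1) * coeff W a * ?\<chi> a z) = 0"
      and a: "a \<in> keys W"
    show "(e2pi (pairing a g) - 1) * coeff W a = 0"
      by (rule monomials_linearly_independent[OF _ _ a]) (use z in auto)
  qed (auto intro!: sum.neutral)
  also have "\<dots> \<longleftrightarrow> (\<forall>a\<in>keys W. pairing a g \<in> \<int>)"
    by (auto simp: e2pi_eq_1_iff in_keys_iff)
  finally show ?thesis by (simp add: Gmax_def)
qed

text \<open>Products in \<open>QZ\<close> are taken with \<open>frac\<close>; this allows the action
  to be computed with plain sums of rationals.\<close>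

lemma form_action_cong_Ints:
  assumes "\<And>i. i \<in> S \<Longrightarrow> h i - h' i \<in> \<int>"
  shows "form_action S h p = form_action S h' p"
proof (rule poly_mapping_eqI)
  fix a :: "'a mon"
  have "(\<Sum>i\<in>S. (of_nat (coeff a i) + 1) * h i) - (\<Sum>i\<in>S. (of_nat (coeff a i) + 1) * h' i) \<in> \<int>"
    unfolding sum_subtractf[symmetric] right_diff_distrib[symmetric]
    by (intro Ints_sum Ints_mult Ints_add assms) auto
  then show "coeff (form_action S h p) a = coeff (form_action S h' p) a"
    unfolding coeff_form_action by (simp add: e2pi_eqI)
qed

lemma form_action_compose:
  "form_action S h (form_action S h' p) = form_action S (\<lambda>i. h i + h' i) p"
  by (rule poly_mapping_eqI)
    (simp add: coeff_form_action distrib_left sum.distrib e2pi_add mult.assoc)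

lemma weight_system_iff_pairing:
  assumes "finite I" and "W \<in> carrier (poly_ring I)"
  shows "weight_system I W q \<longleftrightarrow> (\<forall>i\<in>I. q i > 0) \<and> (\<forall>i. i \<notin> I \<longrightarrow> q i = 0) \<and>
    (\<forall>a\<in>keys W. pairing a q = 1)"
proof -
  have "pairing a q = (\<Sum>i\<in>I. of_nat (coeff a i) * q i)" if "a \<in> keys W" for a
    using assms that by (intro pairing_eq) (auto simp: carrier_poly_ring)
  then show ?thesis by (simp add: weight_system_def)
qed

lemma weights_eqI:
  "weight_system I W q \<Longrightarrow> (\<And>q'. weight_system I W q' \<Longrightarrow> q' = q) \<Longrightarrow> weights I W = q"
  unfolding weights_def by (rule the_equality)

lemma pairing_cong: "(\<And>i. i \<in> keys a \<Longrightarrow> h i = h' i) \<Longrightarrow> pairing a h = pairing a h'"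
  unfolding pairing_def by (rule sum.cong) auto

lemma pairing_cong_Ints:
  "(\<And>i. h i - h' i \<in> \<int>) \<Longrightarrow> pairing a h - pairing a h' \<in> \<int>"
  unfolding pairing_def sum_subtractf[symmetric] right_diff_distrib[symmetric]
  by (intro Ints_sum Ints_mult) auto

lemma pairing_uminus: "pairing a (\<lambda>i. - h i) = - pairing a h"
  by (simp add: pairing_def sum_negf)

lemma pairing_add: "pairing a (\<lambda>i. h i + h' i) = pairing a h + pairing a h'"
  by (simp add: pairing_def sum.distrib distrib_left)

lemma pairing_single [simp]: "pairing (Poly_Mapping.single i c) h = of_nat c * h i"
  by (simp add: pairing_def)

section \<open>Arithmetic in the group of rational phases\<close>

lemma QZ_mult [simp]: "g \<otimes>\<^bsub>QZ I\<^esub> h = (\<lambda>i. frac (g i + h i))"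
  by (simp add: QZ_def)

lemma QZ_one [simp]: "\<one>\<^bsub>QZ I\<^esub> = (\<lambda>_. 0)"
  by (simp add: QZ_def)

lemma frac_diff_Ints [simp]: "frac x - x \<in> \<int>"
  by (simp add: frac_def)

lemma QZ_inv:
  assumes "g \<in> carrier (QZ I)"
  shows "inv\<^bsub>QZ I\<^esub> g = (\<lambda>i. frac (- g i))"
proof (rule group.inv_equality[OF comm_group.axioms(2)[OF QZ_comm_group] _ assms])
  show "(\<lambda>i. frac (- g i)) \<otimes>\<^bsub>QZ I\<^esub> g = \<one>\<^bsub>QZ I\<^esub>"
    by (auto simp: frac_def fun_eq_iff)
  show "(\<lambda>i. frac (- g i)) \<in> carrier (QZ I)"
    using assms by (auto simp: QZ_def frac_lt_1)
qed

lemma pairing_QZ_mult: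
  "pairing a (\<lambda>i. frac (g i + h i)) \<in> \<int> \<longleftrightarrow> pairing a g + pairing a h \<in> \<int>"
proof -
  have "pairing a (\<lambda>i. frac (g i + h i)) - (pairing a g + pairing a h) \<in> \<int>"
    unfolding pairing_add[symmetric] by (rule pairing_cong_Ints) simp
  then show ?thesis
    by (metis Ints_add Ints_diff add_diff_cancel_left' diff_add_cancel diff_diff_eq2)
qed

lemma Gmax_subgroup: "subgroup (Gmax I W) (QZ I)"
proof (rule group.subgroupI[OF comm_group.axioms(2)[OF QZ_comm_group]])
  show "Gmax I W \<subseteq> carrier (QZ I)" by (auto simp: Gmax_def)
  have "(\<lambda>_. 0) \<in> Gmax I W"
    by (auto simp: Gmax_iff QZ_def pairing_def)
  then show "Gmax I W \<noteq> {}" by blast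
next
  fix g assume g: "g \<in> Gmax I W"
  have "pairing a (\<lambda>i. frac (- g i)) \<in> \<int>" if "a \<in> keys W" for a
    using g that pairing_QZ_mult[of a "\<lambda>i. - g i" "\<lambda>_. 0"]
    by (simp add: Gmax_iff pairing_uminus) (simp add: pairing_def)
  moreover have "(\<lambda>i. frac (- g i)) \<in> carrier (QZ I)"
    using g by (auto simp: Gmax_def QZ_def frac_lt_1)
  ultimately show "inv\<^bsub>QZ I\<^esub> g \<in> Gmax I W"
    using g by (simp add: Gmax_iff QZ_inv)
next
  fix g h assume "g \<in> Gmax I W" "h \<in> Gmax I W"
  then show "g \<otimes>\<^bsub>QZ I\<^esub> h \<in> Gmax I W"
    by (auto simp: Gmax_iff pairing_QZ_mult) (auto simp: QZ_def frac_lt_1)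
qed

lemma Var_power: "Var i ^ k = Poly_Mapping.single (Poly_Mapping.single i k) 1"
  by (induction k) (auto simp: Var_def monomial_def mult_single single_add[symmetric])

subsection \<open>Jacobian rings\<close>

lemma poly_ring_ring: "ring (poly_ring I)"
  by (rule cring.axioms(1)[OF poly_ring_cring])

lemma poly_ring_a_inv [simp]: "p \<in> carrier (poly_ring I) \<Longrightarrow> a_inv (poly_ring I) p = - p"
  by (rule abelian_group.minus_equality[OF ring.is_abelian_group[OF poly_ring_ring]]) auto

text \<open>Additive inverses come for free as multiples by the constant -1, and commutativity
  covers multiplication from the right.\<close>

lemma poly_ring_idealI:
  assumes "A \<subseteq> carrier (poly_ring I)" and "0 \<in> A"
    and "\<And>p q. p \<in> A \<Longrightarrow> q \<in> A \<Longrightarrow> p + q \<in> A"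
    and "\<And>r p. r \<in> carrier (poly_ring I) \<Longrightarrow> p \<in> A \<Longrightarrow> r * p \<in> A"
  shows "ideal A (poly_ring I)"
proof (rule idealI[OF poly_ring_ring])
  have "- p \<in> A" if "p \<in> A" for p
    using assms(4)[OF poly_ring_Const[of "-1"] that] by simp
  then have "m_inv (add_monoid (poly_ring I)) p \<in> A" if "p \<in> A" for p
    using poly_ring_a_inv[of p I] that assms(1) unfolding a_inv_def by auto
  then show "subgroup A (add_monoid (poly_ring I))"
    by (rule subgroup.intro[rotated 3]) (use assms(1-3) in auto)
next
  fix a x assume "a \<in> A" "x \<in> carrier (poly_ring I)"
  then show "x \<otimes>\<^bsub>poly_ring I\<^esub> a \<in> A" "a \<otimes>\<^bsub>poly_ring I\<^esub> x \<in> A"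
    using assms(4)[of x a] by (simp_all add: mult.commute[of a])
qed

lemma jacobian_ideal_ideal: "ideal (jacobian_ideal I W g) (poly_ring (fixed_vars I g))"
  unfolding jacobian_ideal_def by (rule ring.genideal_ideal[OF poly_ring_ring]) auto

lemma jacobian_ideal_gen:
  "i \<in> fixed_vars I g \<Longrightarrow> pdiff i (restrict_poly (fixed_vars I g) W) \<in> jacobian_ideal I W g"
  unfolding jacobian_ideal_def
  by (rule subsetD[OF ring.genideal_self[OF poly_ring_ring]]) auto

lemma jacobian_ideal_subset: "p \<in> jacobian_ideal I W g \<Longrightarrow> p \<in> carrier (poly_ring (fixed_vars I g))"
  using additive_subgroup.a_subset[OF ideal.axioms(1)[OF jacobian_ideal_ideal]] by blast

lemma jacobian_ideal_0 [simp]: "0 \<in> jacobian_ideal I W g"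
  using additive_subgroup.zero_closed[OF ideal.axioms(1)[OF jacobian_ideal_ideal[of I W g]]] by simp

lemma jacobian_ideal_add [intro]:
  "p \<in> jacobian_ideal I W g \<Longrightarrow> q \<in> jacobian_ideal I W g \<Longrightarrow> p + q \<in> jacobian_ideal I W g"
  using additive_subgroup.a_closed[OF ideal.axioms(1)[OF jacobian_ideal_ideal]] by fastforce

lemma jacobian_ideal_mult [intro]:
  "r \<in> carrier (poly_ring (fixed_vars I g)) \<Longrightarrow> p \<in> jacobian_ideal I W g
    \<Longrightarrow> r * p \<in> jacobian_ideal I W g"
  using ideal.I_l_closed[OF jacobian_ideal_ideal] by fastforce

lemma jacobian_ideal_Const_mult:
  "p \<in> jacobian_ideal I W g \<Longrightarrow> Const c * p \<in> jacobian_ideal I W g"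
  by (rule jacobian_ideal_mult) auto

lemma jacobian_ideal_uminus [intro]:
  "p \<in> jacobian_ideal I W g \<Longrightarrow> - p \<in> jacobian_ideal I W g"
  using jacobian_ideal_Const_mult[of p I W g "-1"] by simp

lemma jacobian_ideal_diff [intro]:
  "p \<in> jacobian_ideal I W g \<Longrightarrow> q \<in> jacobian_ideal I W g \<Longrightarrow> p - q \<in> jacobian_ideal I W g"
  using jacobian_ideal_add[OF _ jacobian_ideal_uminus] by fastforce

text \<open>The ring elements satisfying \<open>P\<close> form an ideal containing the generators,
  so minimality of the generated ideal applies. This replaces explicit combinations of partial
  derivatives.\<close>

lemma jacobian_ideal_induct [consumes 1, case_names gen zero add mult]:
  assumes "p \<in> jacobian_ideal I W g"
    and "\<And>i. i \<in> fixed_vars I g \<Longrightarrow> P (pdiff i (restrict_poly (fixed_vars I g) W))"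
    and "P 0"
    and "\<And>p q. P p \<Longrightarrow> P q \<Longrightarrow> P (p + q)"
    and "\<And>r p. r \<in> carrier (poly_ring (fixed_vars I g)) \<Longrightarrow> P p \<Longrightarrow> P (r * p)"
  shows "P p"
proof -
  let ?R = "poly_ring (fixed_vars I g)"
  have "ideal {p \<in> carrier ?R. P p} ?R"
    by (rule poly_ring_idealI) (use assms(3-5) in auto)
  then have "jacobian_ideal I W g \<subseteq> {p \<in> carrier ?R. P p}"
    unfolding jacobian_ideal_def
    by (rule ring.genideal_minimal[OF poly_ring_ring]) (use assms(2) in auto)
  with assms(1) show ?thesis by blast
qed

lemma jacobian_class_eq: "jacobian_class I W g p = (\<lambda>j. j + p) ` jacobian_ideal I W g"
  by (auto simp: jacobian_class_def a_r_coset_def')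

lemma jacobian_class_eq_iff:
  "jacobian_class I W g p = jacobian_class I W g q \<longleftrightarrow> p - q \<in> jacobian_ideal I W g"
proof
  assume "jacobian_class I W g p = jacobian_class I W g q"
  then have "0 + p \<in> jacobian_class I W g q"
    unfolding jacobian_class_eq by (metis imageI jacobian_ideal_0)
  then show "p - q \<in> jacobian_ideal I W g"
    by (auto simp: jacobian_class_eq)
next
  have *: "jacobian_class I W g p \<subseteq> jacobian_class I W g q"
    if "p - q \<in> jacobian_ideal I W g" for p q
  proof
    fix x assume "x \<in> jacobian_class I W g p"
    then have "x - q \<in> jacobian_ideal I W g"
      using that by (auto simp: jacobian_class_eq add_diff_eq[symmetric])
    then show "x \<in> jacobian_class I W g q"
      by (auto simp: jacobian_class_eq image_iff intro: bexI[of _ "x - q"])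
  qed
  assume "p - q \<in> jacobian_ideal I W g"
  moreover from jacobian_ideal_uminus[OF this] have "q - p \<in> jacobian_ideal I W g" by simp
  ultimately show "jacobian_class I W g p = jacobian_class I W g q"
    using * by blast
qed

lemma jacobian_class_ring_hom:
  "jacobian_class I W g \<in> ring_hom (poly_ring (fixed_vars I g)) (jacobian_ring I W g)"
  unfolding jacobian_class_def[abs_def] jacobian_ring_def
  by (rule ideal.rcos_ring_hom[OF jacobian_ideal_ideal])

lemma jacobian_ring_carrier:
  "carrier (jacobian_ring I W g) = jacobian_class I W g ` carrier (poly_ring (fixed_vars I g))"
  unfolding jacobian_class_def[abs_def] jacobian_ring_def
  by (auto simp: FactRing_def A_RCOSETS_def' )

lemma jacobian_ring_zero: "zero (jacobian_ring I W g) = jacobian_class I W g 0"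
  by (auto simp: jacobian_class_eq jacobian_ring_def FactRing_def)

lemma jacobian_class_eq_zero_iff:
  "jacobian_class I W g p = zero (jacobian_ring I W g) \<longleftrightarrow> p \<in> jacobian_ideal I W g"
  by (simp add: jacobian_ring_zero jacobian_class_eq_iff)

lemma jacobian_ring_add:
  assumes "p \<in> carrier (poly_ring (fixed_vars I g))" "q \<in> carrier (poly_ring (fixed_vars I g))"
  shows "jacobian_class I W g p \<oplus>\<^bsub>jacobian_ring I W g\<^esub> jacobian_class I W g q
    = jacobian_class I W g (p + q)"
  using ring_hom_add[OF jacobian_class_ring_hom assms] by simp

lemma jacobian_ring_smult:
  assumes "p \<in> carrier (poly_ring (fixed_vars I g))"
  shows "jacobian_class I W g (Const c) \<otimes>\<^bsub>jacobian_ring I W g\<^esub> jacobian_class I W g p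
    = jacobian_class I W g (Const c * p)"
  using ring_hom_mult[OF jacobian_class_ring_hom poly_ring_Const assms] by simp

lemma jacobian_ring_ring: "ring (jacobian_ring I W g)"
  unfolding jacobian_ring_def by (rule ideal.quotient_is_ring[OF jacobian_ideal_ideal])

text \<open>The generator \<open>\<partial>W\<^sub>g/\<partial>z\<^sub>i\<close> is an eigenvector of every diagonal symmetry: its eigenvalue is
  the one of \<open>\<omega>\<^sub>g\<close> divided by the one of \<open>z\<^sub>i\<close>.\<close>

lemma form_action_jacobian_ideal:
  assumes I: "finite I" and h: "\<forall>a\<in>keys W. pairing a h \<in> \<int>" and p: "p \<in> jacobian_ideal I W g"
  shows "form_action (fixed_vars I g) h p \<in> jacobian_ideal I W g"
  using p
proof (induction rule: jacobian_ideal_induct)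
  case (gen i)
  let ?F = "fixed_vars I g"
  have F: "finite ?F" using I by (simp add: fixed_vars_def)
  have "form_action ?F h (pdiff i (restrict_poly ?F W))
      = Const (e2pi (sum h ?F - h i)) * pdiff i (restrict_poly ?F W)"
  proof (rule poly_mapping_eqI)
    fix a :: "'a mon"
    let ?b = "a + Poly_Mapping.single i (1 :: nat)"
    \<comment> \<open>A nonzero coefficient at \<open>a\<close> can only come from the monomial
      \<open>?b\<close> of \<open>W\<close>, and the two phases compared here differ by the integer
      \<open>pairing ?b h\<close>.\<close>
    have "e2pi (\<Sum>j\<in>?F. (of_nat (coeff a j) + 1) * h j) = e2pi (sum h ?F - h i)"
      if b: "keys ?b \<subseteq> ?F" "?b \<in> keys W"
    proof (rule e2pi_eqI)
      have "pairing ?b h = (\<Sum>j\<in>?F. of_nat (coeff a j) * h j + (if j = i then h j else 0))"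
        unfolding pairing_eq[OF F b(1)]
        by (rule sum.cong) (auto simp: lookup_add lookup_single when_def algebra_simps)
      also have "\<dots> = (\<Sum>j\<in>?F. of_nat (coeff a j) * h j) + h i"
        using F gen by (simp add: sum.distrib)
      finally have "(\<Sum>j\<in>?F. (of_nat (coeff a j) + 1) * h j) - (sum h ?F - h i) = pairing ?b h"
        by (simp add: sum.distrib distrib_right)
      then show "(\<Sum>j\<in>?F. (of_nat (coeff a j) + 1) * h j) - (sum h ?F - h i) \<in> \<int>"
        using h b(2) by simp
    qed
    then show "coeff (form_action ?F h (pdiff i (restrict_poly ?F W))) a
        = coeff (Const (e2pi (sum h ?F - h i)) * pdiff i (restrict_poly ?F W)) a"
      by (cases "coeff W ?b = 0")
        (auto simp: coeff_form_action coeff_pdiff coeff_restrict_poly in_keys_iff)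
  qed
  then show ?case
    by (metis gen jacobian_ideal_gen jacobian_ideal_Const_mult)
next
  case zero
  have "form_action (fixed_vars I g) h 0 = (0 :: 'a mpoly)"
    by (rule poly_mapping_eqI) (simp add: coeff_form_action)
  then show ?case by simp
next
  case (add p q)
  then show ?case by (auto simp: form_action_add)
next
  case (mult r p)
  then show ?case by (auto simp: form_action_mult in_poly_ring_iff)
qed

lemma form_action_inverse: "form_action S h (form_action S (\<lambda>i. - h i) p) = p"
proof (rule poly_mapping_eqI)
  fix a
  have "e2pi (\<Sum>i\<in>S. (of_nat (coeff a i) + 1) * h i) * e2pi (\<Sum>i\<in>S. (of_nat (coeff a i) + 1) * - h i) = 1"
    using e2pi_uminus[of "\<Sum>i\<in>S. (of_nat (coeff a i) + 1) * h i"]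
    by (simp add: sum_negf mult.commute)
  then show "coeff (form_action S h (form_action S (\<lambda>i. - h i) p)) a = coeff p a"
    by (simp add: coeff_form_action mult.assoc[symmetric])
qed

text \<open>Negating \<open>h\<close> inverts the action, so stability of the ideal improves to
  equality of sets. Hence a class is mapped onto a whole class and not merely into one.\<close>

lemma form_action_jacobian_class:
  assumes I: "finite I" and h: "\<forall>a\<in>keys W. pairing a h \<in> \<int>"
  shows "form_action (fixed_vars I g) h ` jacobian_class I W g p
    = jacobian_class I W g (form_action (fixed_vars I g) h p)"
proof -
  let ?f = "form_action (fixed_vars I g) h"
  have "?f ` jacobian_ideal I W g = jacobian_ideal I W g"
  proof
    show "?f ` jacobian_ideal I W g \<subseteq> jacobian_ideal I W g"
      using form_action_jacobian_ideal[OF I h] by blast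
    show "jacobian_ideal I W g \<subseteq> ?f ` jacobian_ideal I W g"
    proof
      fix p assume "p \<in> jacobian_ideal I W g"
      moreover have "\<forall>a\<in>keys W. pairing a (\<lambda>i. - h i) \<in> \<int>"
        using h by (simp add: pairing_uminus)
      ultimately have "form_action (fixed_vars I g) (\<lambda>i. - h i) p \<in> jacobian_ideal I W g"
        by (rule form_action_jacobian_ideal[OF I, rotated])
      then show "p \<in> ?f ` jacobian_ideal I W g"
        by (metis form_action_inverse imageI)
    qed
  qed
  moreover have "?f ` (\<lambda>j. j + p) ` A = (\<lambda>j. j + ?f p) ` ?f ` A" for A
    by (simp add: image_image form_action_add)
  ultimately show ?thesis
    by (simp add: jacobian_class_eq)
qed

text \<open>Passes from setwise invariance of a class to a congruence for a representative, the form
  in which invariance is handled from here on.\<close>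

lemma jacobian_class_invariant_iff:
  assumes "finite I" and "\<And>h a. h \<in> H \<Longrightarrow> a \<in> keys W \<Longrightarrow> pairing a h \<in> \<int>"
    and "p \<in> carrier (poly_ring (fixed_vars I g))"
  shows "jacobian_class I W g p \<in> invariant_sector I W H g
    \<longleftrightarrow> (\<forall>h\<in>H. form_action (fixed_vars I g) h p - p \<in> jacobian_ideal I W g)"
  using assms(3)
  by (auto simp: invariant_sector_def jacobian_ring_carrier assms
      form_action_jacobian_class jacobian_class_eq_iff)

lemma invariant_sectorE:
  assumes "C \<in> invariant_sector I W H g"
  obtains p where "p \<in> carrier (poly_ring (fixed_vars I g))" "C = jacobian_class I W g p"
  using assms by (auto simp: invariant_sector_def jacobian_ring_carrier)

lemma restrict_poly_0 [simp]: "restrict_poly S 0 = 0"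
  by (rule poly_mapping_eqI) (simp add: coeff_restrict_poly)

lemma jacobian_ideal_sum:
  "(\<And>x. x \<in> A \<Longrightarrow> f x \<in> jacobian_ideal I W g) \<Longrightarrow> sum f A \<in> jacobian_ideal I W g"
  by (induction A rule: infinite_finite_induct) auto

subsection \<open>State spaces\<close>

lemma invariant_sector_carrier:
  "C \<in> invariant_sector I W H g \<Longrightarrow> C \<in> carrier (jacobian_ring I W g)"
  by (simp add: invariant_sector_def)

lemma invariant_sector_zero:
  assumes "finite I" and "\<And>h a. h \<in> H \<Longrightarrow> a \<in> keys W \<Longrightarrow> pairing a h \<in> \<int>"
  shows "zero (jacobian_ring I W g) \<in> invariant_sector I W H g"
  unfolding jacobian_ring_zero
  by (subst jacobian_class_invariant_iff[OF assms])
    (auto simp: form_action_jacobian_ideal assms)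

lemma invariant_sector_add:
  assumes H: "finite I" "\<And>h a. h \<in> H \<Longrightarrow> a \<in> keys W \<Longrightarrow> pairing a h \<in> \<int>"
    and "C \<in> invariant_sector I W H g" and "D \<in> invariant_sector I W H g"
  shows "C \<oplus>\<^bsub>jacobian_ring I W g\<^esub> D \<in> invariant_sector I W H g"
proof -
  obtain p q where p: "p \<in> carrier (poly_ring (fixed_vars I g))" "C = jacobian_class I W g p"
    and q: "q \<in> carrier (poly_ring (fixed_vars I g))" "D = jacobian_class I W g q"
    using assms(3,4) by (metis invariant_sectorE)
  have "form_action (fixed_vars I g) h (p + q) - (p + q) \<in> jacobian_ideal I W g" if "h \<in> H" for h
  proof -
    have "form_action (fixed_vars I g) h (p + q) - (p + q)
        = (form_action (fixed_vars I g) h p - p) + (form_action (fixed_vars I g) h q - q)"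
      by (simp add: form_action_add)
    also have "\<dots> \<in> jacobian_ideal I W g"
      using that assms(3,4) p q
      by (intro jacobian_ideal_add) (auto simp: jacobian_class_invariant_iff[OF H])
    finally show ?thesis .
  qed
  with p q show ?thesis
    by (auto simp: jacobian_ring_add jacobian_class_invariant_iff[OF H] poly_ring_add)
qed

lemma invariant_sector_smult:
  assumes H: "finite I" "\<And>h a. h \<in> H \<Longrightarrow> a \<in> keys W \<Longrightarrow> pairing a h \<in> \<int>"
    and "C \<in> invariant_sector I W H g"
  shows "jacobian_class I W g (Const c) \<otimes>\<^bsub>jacobian_ring I W g\<^esub> C \<in> invariant_sector I W H g"
proof -
  obtain p where p: "p \<in> carrier (poly_ring (fixed_vars I g))" "C = jacobian_class I W g p"
    using assms(3) by (metis invariant_sectorE)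
  have "form_action (fixed_vars I g) h (Const c * p) - Const c * p \<in> jacobian_ideal I W g"
    if "h \<in> H" for h
  proof -
    have "form_action (fixed_vars I g) h (Const c * p) - Const c * p
        = Const c * (form_action (fixed_vars I g) h p - p)"
      by (simp add: form_action_Const_mult right_diff_distrib)
    also have "\<dots> \<in> jacobian_ideal I W g"
      using that assms(3) p
      by (intro jacobian_ideal_Const_mult) (auto simp: jacobian_class_invariant_iff[OF H])
    finally show ?thesis .
  qed
  with p show ?thesis
    by (auto simp: jacobian_ring_smult jacobian_class_invariant_iff[OF H] poly_ring_mult poly_ring_Const)
qed

lemma state_space_carrier_iff:
  "s \<in> carrier (state_space I W H) \<longleftrightarrow>
    s \<in> Pi\<^sub>E H (invariant_sector I W H) \<and> finite {g \<in> H. s g \<noteq> \<zero>\<^bsub>jacobian_ring I W g\<^esub>}"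
  by (simp add: state_space_def)

lemma state_space_zero_apply: "g \<in> H \<Longrightarrow> \<zero>\<^bsub>state_space I W H\<^esub> g = \<zero>\<^bsub>jacobian_ring I W g\<^esub>"
  by (simp add: state_space_def)

lemma state_space_add_apply:
  "g \<in> H \<Longrightarrow> (s \<oplus>\<^bsub>state_space I W H\<^esub> t) g = s g \<oplus>\<^bsub>jacobian_ring I W g\<^esub> t g"
  by (simp add: state_space_def)

lemma state_space_smult_apply:
  "g \<in> H \<Longrightarrow> (c \<odot>\<^bsub>state_space I W H\<^esub> s) g
    = jacobian_class I W g (Const c) \<otimes>\<^bsub>jacobian_ring I W g\<^esub> s g"
  by (simp add: state_space_def)

lemma state_space_extensional:
  "\<zero>\<^bsub>state_space I W H\<^esub> \<in> extensional H" "s \<oplus>\<^bsub>state_space I W H\<^esub> t \<in> extensional H"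
  "c \<odot>\<^bsub>state_space I W H\<^esub> s \<in> extensional H"
  by (simp_all add: state_space_def)

lemma state_space_eqI:
  "s \<in> extensional H \<Longrightarrow> t \<in> extensional H \<Longrightarrow> (\<And>g. g \<in> H \<Longrightarrow> s g = t g) \<Longrightarrow> s = t"
  by (rule extensionalityI)

lemma state_space_carrierD:
  assumes "s \<in> carrier (state_space I W H)"
  shows "s \<in> extensional H" and "g \<in> H \<Longrightarrow> s g \<in> invariant_sector I W H g"
    and "g \<in> H \<Longrightarrow> s g \<in> carrier (jacobian_ring I W g)"
    and "finite {g \<in> H. s g \<noteq> \<zero>\<^bsub>jacobian_ring I W g\<^esub>}"
  using assms by (auto simp: state_space_carrier_iff PiE_def dest: invariant_sector_carrier)

lemma state_space_zero_closed:
  assumes "finite I" and "\<And>h a. h \<in> H \<Longrightarrow> a \<in> keys W \<Longrightarrow> pairing a h \<in> \<int>"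
  shows "\<zero>\<^bsub>state_space I W H\<^esub> \<in> carrier (state_space I W H)"
  unfolding state_space_carrier_iff PiE_iff
  using assms by (auto simp: state_space_zero_apply state_space_extensional invariant_sector_zero
      cong: conj_cong)

lemma state_space_add_closed:
  assumes H: "finite I" "\<And>h a. h \<in> H \<Longrightarrow> a \<in> keys W \<Longrightarrow> pairing a h \<in> \<int>"
    and s: "s \<in> carrier (state_space I W H)" and t: "t \<in> carrier (state_space I W H)"
  shows "s \<oplus>\<^bsub>state_space I W H\<^esub> t \<in> carrier (state_space I W H)"
proof -
  have "{g \<in> H. s g \<oplus>\<^bsub>jacobian_ring I W g\<^esub> t g \<noteq> \<zero>\<^bsub>jacobian_ring I W g\<^esub>}
      \<subseteq> {g \<in> H. s g \<noteq> \<zero>\<^bsub>jacobian_ring I W g\<^esub>} \<union> {g \<in> H. t g \<noteq> \<zero>\<^bsub>jacobian_ring I W g\<^esub>}"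
    using state_space_carrierD(3)[OF t]
    by (auto simp: abelian_monoid.l_zero abelian_group.axioms ring.is_abelian_group jacobian_ring_ring)
  then have "finite {g \<in> H. s g \<oplus>\<^bsub>jacobian_ring I W g\<^esub> t g \<noteq> \<zero>\<^bsub>jacobian_ring I W g\<^esub>}"
    using state_space_carrierD(4)[OF s] state_space_carrierD(4)[OF t] finite_subset by blast
  then have "finite {g \<in> H. (s \<oplus>\<^bsub>state_space I W H\<^esub> t) g \<noteq> \<zero>\<^bsub>jacobian_ring I W g\<^esub>}"
    by (simp add: state_space_add_apply cong: conj_cong)
  then show ?thesis
    using state_space_carrierD(2)[OF s] state_space_carrierD(2)[OF t] invariant_sector_add[OF H]
    by (auto simp: state_space_carrier_iff PiE_iff state_space_add_apply state_space_extensional)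
qed

lemma jacobian_ring_smult_zero:
  "jacobian_class I W g (Const c) \<otimes>\<^bsub>jacobian_ring I W g\<^esub> \<zero>\<^bsub>jacobian_ring I W g\<^esub>
    = \<zero>\<^bsub>jacobian_ring I W g\<^esub>"
  unfolding jacobian_ring_zero by (simp add: jacobian_ring_smult)

lemma state_space_smult_closed:
  assumes H: "finite I" "\<And>h a. h \<in> H \<Longrightarrow> a \<in> keys W \<Longrightarrow> pairing a h \<in> \<int>"
    and s: "s \<in> carrier (state_space I W H)"
  shows "c \<odot>\<^bsub>state_space I W H\<^esub> s \<in> carrier (state_space I W H)"
proof -
  have "{g \<in> H. (c \<odot>\<^bsub>state_space I W H\<^esub> s) g \<noteq> \<zero>\<^bsub>jacobian_ring I W g\<^esub>}
      \<subseteq> {g \<in> H. s g \<noteq> \<zero>\<^bsub>jacobian_ring I W g\<^esub>}"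
    by (auto simp: state_space_smult_apply jacobian_ring_smult_zero)
  then have "finite {g \<in> H. (c \<odot>\<^bsub>state_space I W H\<^esub> s) g \<noteq> \<zero>\<^bsub>jacobian_ring I W g\<^esub>}"
    using state_space_carrierD(4)[OF s] finite_subset by blast
  then show ?thesis
    using state_space_carrierD(2)[OF s] invariant_sector_smult[OF H]
    by (auto simp: state_space_carrier_iff PiE_iff state_space_smult_apply state_space_extensional)
qed

lemma state_space_abelian_group:
  assumes H: "finite I" "\<And>h a. h \<in> H \<Longrightarrow> a \<in> keys W \<Longrightarrow> pairing a h \<in> \<int>"
  shows "abelian_group (state_space I W H)"
proof -
  let ?V = "state_space I W H"
  note Q = ring.is_abelian_group[OF jacobian_ring_ring]
  note Q' = abelian_group.axioms(1)[OF Q]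
  note ext = state_space_eqI[OF state_space_extensional(2)]
  show ?thesis
  proof (rule abelian_groupI)
    show "x \<oplus>\<^bsub>?V\<^esub> y \<in> carrier ?V" if "x \<in> carrier ?V" "y \<in> carrier ?V" for x y
      using state_space_add_closed[OF H that] by simp
    show "\<zero>\<^bsub>?V\<^esub> \<in> carrier ?V"
      using state_space_zero_closed[OF H] by simp
    show "x \<oplus>\<^bsub>?V\<^esub> y \<oplus>\<^bsub>?V\<^esub> z = x \<oplus>\<^bsub>?V\<^esub> (y \<oplus>\<^bsub>?V\<^esub> z)"
      if "x \<in> carrier ?V" "y \<in> carrier ?V" "z \<in> carrier ?V" for x y z
      by (rule ext[OF state_space_extensional(2)])
        (simp add: state_space_add_apply abelian_monoid.a_assoc[OF Q'] that[THEN state_space_carrierD(3)])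
    show "x \<oplus>\<^bsub>?V\<^esub> y = y \<oplus>\<^bsub>?V\<^esub> x" if "x \<in> carrier ?V" "y \<in> carrier ?V" for x y
      by (rule ext[OF state_space_extensional(2)])
        (simp add: state_space_add_apply abelian_monoid.a_comm[OF Q'] that[THEN state_space_carrierD(3)])
    show "\<zero>\<^bsub>?V\<^esub> \<oplus>\<^bsub>?V\<^esub> x = x" if "x \<in> carrier ?V" for x
      by (rule ext[OF state_space_carrierD(1)[OF that]])
        (simp add: state_space_add_apply state_space_zero_apply abelian_monoid.l_zero[OF Q']
          that[THEN state_space_carrierD(3)])
    show "\<exists>y\<in>carrier ?V. y \<oplus>\<^bsub>?V\<^esub> x = \<zero>\<^bsub>?V\<^esub>" if x: "x \<in> carrier ?V" for x
    proof (intro bexI ext[OF state_space_extensional(1)])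
      show "(- 1) \<odot>\<^bsub>?V\<^esub> x \<in> carrier ?V"
        by (rule state_space_smult_closed[OF H x])
      fix g assume g: "g \<in> H"
      then obtain p where "p \<in> carrier (poly_ring (fixed_vars I g))" "x g = jacobian_class I W g p"
        using state_space_carrierD(2)[OF x] invariant_sectorE by metis
      moreover from this have "jacobian_class I W g (- 1) \<otimes>\<^bsub>jacobian_ring I W g\<^esub> x g
          = jacobian_class I W g (- p)"
        using jacobian_ring_smult[of p I g W "-1"] by simp
      ultimately show "((- 1) \<odot>\<^bsub>?V\<^esub> x \<oplus>\<^bsub>?V\<^esub> x) g = \<zero>\<^bsub>?V\<^esub> g"
        using g by (simp add: state_space_add_apply state_space_smult_apply state_space_zero_apply
            jacobian_ring_add jacobian_ring_zero poly_ring_uminus)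
    qed
  qed
qed

section \<open>Spans under linear maps, dimension of fixed loci, generators\<close>

text \<open>The span is an intersection of submodules. The preimage under \<open>f\<close> of any
  submodule containing \<open>T\<close> is a submodule containing \<open>S\<close>, hence it
  contains the span of \<open>S\<close>.\<close>

lemma module_span_image_subset:
  assumes M: "abelian_group M" and N: "abelian_group N"
    and f: "\<And>x. x \<in> carrier M \<Longrightarrow> f x \<in> carrier N"
    and add: "\<And>x y. x \<in> carrier M \<Longrightarrow> y \<in> carrier M \<Longrightarrow> f (x \<oplus>\<^bsub>M\<^esub> y) = f x \<oplus>\<^bsub>N\<^esub> f y"
    and smult: "\<And>c x. c \<in> carrier R \<Longrightarrow> x \<in> carrier M \<Longrightarrow> f (c \<odot>\<^bsub>M\<^esub> x) = c \<odot>\<^bsub>N\<^esub> f x"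
    and closed: "\<And>c x. c \<in> carrier R \<Longrightarrow> x \<in> carrier M \<Longrightarrow> c \<odot>\<^bsub>M\<^esub> x \<in> carrier M"
    and S: "S \<subseteq> carrier M" and fS: "f ` S \<subseteq> module_span R N T"
  shows "f ` module_span R M S \<subseteq> module_span R N T"
proof clarify
  fix x assume x: "x \<in> module_span R M S"
  have hom: "group_hom (add_monoid M) (add_monoid N) f"
    using abelian_group.a_group[OF M] abelian_group.a_group[OF N] f add
    by (auto simp: group_hom_def group_hom_axioms_def hom_def)
  show "f x \<in> module_span R N T"
    unfolding module_span_def
  proof clarify
    fix P assume P: "submodule P R N" and T: "T \<subseteq> P"
    have sub: "subgroup P (add_monoid N)" by (rule submodule.axioms(1)[OF P])
    have "subgroup {x \<in> carrier M. f x \<in> P} (add_monoid M)"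
    proof (rule group.subgroupI[OF abelian_group.a_group[OF M]])
      show "{x \<in> carrier M. f x \<in> P} \<noteq> {}"
        using group_hom.hom_one[OF hom] subgroup.one_closed[OF sub]
          abelian_monoid.zero_closed[OF abelian_group.axioms(1)[OF M]] by auto
    next
      fix a assume "a \<in> {x \<in> carrier M. f x \<in> P}"
      then show "inv\<^bsub>add_monoid M\<^esub> a \<in> {x \<in> carrier M. f x \<in> P}"
        using group_hom.hom_inv[OF hom, of a] subgroup.m_inv_closed[OF sub, of "f a"]
          group.inv_closed[OF abelian_group.a_group[OF M], of a] by auto
    next
      fix a b assume "a \<in> {x \<in> carrier M. f x \<in> P}" "b \<in> {x \<in> carrier M. f x \<in> P}"
      then show "a \<otimes>\<^bsub>add_monoid M\<^esub> b \<in> {x \<in> carrier M. f x \<in> P}"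
        using add[of a b] subgroup.m_closed[OF sub, of "f a" "f b"]
          abelian_monoid.a_closed[OF abelian_group.axioms(1)[OF M]] by auto
    qed auto
    then have "submodule {x \<in> carrier M. f x \<in> P} R M"
      using closed smult submodule.smult_closed[OF P]
      by (auto simp: submodule_def submodule_axioms_def)
    moreover have "S \<subseteq> {x \<in> carrier M. f x \<in> P}"
      using S fS P T by (auto simp: module_span_def)
    ultimately show "f x \<in> P"
      using x unfolding module_span_def by blast
  qed
qed

lemma module_span_superset: "S \<subseteq> module_span R M S"
  by (auto simp: module_span_def)

lemma module_span_zero: "\<zero>\<^bsub>M\<^esub> \<in> module_span R M S"
  using subgroup.one_closed[OF submodule.axioms(1)] by (fastforce simp: module_span_def)

text \<open>Adjoining 0 to a generating set does not change its span, so generators need to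
  correspond only up to 0. The inclusion of images is applied to \<open>f\<close> and to its
  inverse.\<close>

lemma module_iso_image_span:
  assumes M: "abelian_group M" and N: "abelian_group N" and f: "f \<in> module_iso R M N"
    and Mc: "\<And>c x. c \<in> carrier R \<Longrightarrow> x \<in> carrier M \<Longrightarrow> c \<odot>\<^bsub>M\<^esub> x \<in> carrier M"
    and Nc: "\<And>c x. c \<in> carrier R \<Longrightarrow> x \<in> carrier N \<Longrightarrow> c \<odot>\<^bsub>N\<^esub> x \<in> carrier N"
    and S: "S \<subseteq> carrier M" and T: "T \<subseteq> carrier N"
    and ST: "f ` S \<subseteq> insert \<zero>\<^bsub>N\<^esub> T" and TS: "T \<subseteq> insert \<zero>\<^bsub>N\<^esub> (f ` S)"
  shows "f ` module_span R M S = module_span R N T"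
proof
  have bij: "bij_betw f (carrier M) (carrier N)"
    and add: "\<And>x y. x \<in> carrier M \<Longrightarrow> y \<in> carrier M \<Longrightarrow> f (x \<oplus>\<^bsub>M\<^esub> y) = f x \<oplus>\<^bsub>N\<^esub> f y"
    and smult: "\<And>c x. c \<in> carrier R \<Longrightarrow> x \<in> carrier M \<Longrightarrow> f (c \<odot>\<^bsub>M\<^esub> x) = c \<odot>\<^bsub>N\<^esub> f x"
    using f by (auto simp: module_iso_def)
  have fc: "f x \<in> carrier N" if "x \<in> carrier M" for x
    using bij that by (rule bij_betw_apply)
  show "f ` module_span R M S \<subseteq> module_span R N T"
    using ST module_span_superset[of T R N] module_span_zero[of N R T]
    by (intro module_span_image_subset[OF M N fc add smult Mc S]) auto
  define f' where "f' = inv_into (carrier M) f"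
  have f'f: "f' (f x) = x" if "x \<in> carrier M" for x
    unfolding f'_def by (rule bij_betw_inv_into_left[OF bij that])
  have f': "f' y \<in> carrier M" "f (f' y) = y" if "y \<in> carrier N" for y
    unfolding f'_def using bij_betw_inv_into_right[OF bij that]
      bij_betw_apply[OF bij_betw_inv_into[OF bij] that] by auto
  have add': "f' (x \<oplus>\<^bsub>N\<^esub> y) = f' x \<oplus>\<^bsub>M\<^esub> f' y" if "x \<in> carrier N" "y \<in> carrier N" for x y
    using that f'f[of "f' x \<oplus>\<^bsub>M\<^esub> f' y"] add[of "f' x" "f' y"] f'
      abelian_monoid.a_closed[OF abelian_group.axioms(1)[OF M]] by auto
  have smult': "f' (c \<odot>\<^bsub>N\<^esub> x) = c \<odot>\<^bsub>M\<^esub> f' x" if "c \<in> carrier R" "x \<in> carrier N" for c x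
    using that f'f[of "c \<odot>\<^bsub>M\<^esub> f' x"] smult[of c "f' x"] f' Mc by auto
  have "f \<zero>\<^bsub>M\<^esub> = \<zero>\<^bsub>N\<^esub>"
    using group_hom.hom_one[of "add_monoid M" "add_monoid N" f]
      abelian_group.a_group[OF M] abelian_group.a_group[OF N] fc add
    by (auto simp: group_hom_def group_hom_axioms_def hom_def)
  then have "f' \<zero>\<^bsub>N\<^esub> = \<zero>\<^bsub>M\<^esub>"
    using f'f abelian_monoid.zero_closed[OF abelian_group.axioms(1)[OF M]] by metis
  then have f'T: "f' ` T \<subseteq> module_span R M S"
    using TS f'f S module_span_superset[of S R M] module_span_zero[of M R S] by fastforce
  have *: "f' ` module_span R N T \<subseteq> module_span R M S"
  proof (rule module_span_image_subset[where f = f', OF N M _ _ _ _ T f'T])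
    show "f' x \<in> carrier M" if "x \<in> carrier N" for x by (rule f'(1)[OF that])
    show "f' (x \<oplus>\<^bsub>N\<^esub> y) = f' x \<oplus>\<^bsub>M\<^esub> f' y" if "x \<in> carrier N" "y \<in> carrier N" for x y
      by (rule add'[OF that])
    show "f' (c \<odot>\<^bsub>N\<^esub> x) = c \<odot>\<^bsub>M\<^esub> f' x" "c \<odot>\<^bsub>N\<^esub> x \<in> carrier N"
      if "c \<in> carrier R" "x \<in> carrier N" for c x
      by (rule smult'[OF that], rule Nc[OF that])
  qed
  have "submodule (carrier N) R N"
    using group.subgroup_self[OF abelian_group.a_group[OF N]] Nc
    by (auto simp: submodule_def submodule_axioms_def)
  then have "module_span R N T \<subseteq> carrier N"
    using T by (auto simp: module_span_def)
  with * show "module_span R N T \<subseteq> f ` module_span R M S"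
    using f'(2) by (force intro: rev_image_eqI)
qed

text \<open>Entries lie in \<open>[0,1)\<close>, so a coordinate has trivial phase only if its entry
  is 0. The fixed locus is thus a coordinate subspace, with the unit vectors \<open>e i\<close> as a
  basis.\<close>

lemma fixed_dim_eq_card:
  assumes I: "finite I" and g: "g \<in> carrier (QZ I)"
  shows "fixed_dim I g = card (fixed_vars I g)"
proof -
  let ?S = "fixed_vars I g"
  define e :: "'a \<Rightarrow> 'a \<Rightarrow> complex" where "e = (\<lambda>i j. if j = i then 1 else 0)"
  interpret V: vector_space "\<lambda>(c::complex) (z :: 'a \<Rightarrow> complex) i. c * z i"
    by unfold_locales (auto simp: fun_eq_iff algebra_simps)
  have app: "(\<Sum>x\<in>A. f x) j = (\<Sum>x\<in>A. f x j)" for A and f :: "'b \<Rightarrow> 'a \<Rightarrow> complex" and j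
    by (induction A rule: infinite_finite_induct) auto
  have S: "finite ?S" using I by (simp add: fixed_vars_def)
  have inj: "inj_on e A" for A
    by (rule inj_onI) (metis e_def zero_neq_one)
  have "e2pi (g i) = 1 \<longleftrightarrow> g i = 0" if "i \<in> I" for i
    using g that by (auto simp: e2pi_eq_1_iff QZ_def elim!: Ints_cases)
  then have Fix: "Fix I g = affine_space ?S"
    by (force simp: Fix_def affine_space_def fixed_vars_def)
  have "V.dim (Fix I g) = card (e ` ?S)"
  proof (rule V.dim_unique[OF _ _ _ refl])
    show "e ` ?S \<subseteq> Fix I g"
      by (auto simp: Fix affine_space_def e_def)
    show "Fix I g \<subseteq> V.span (e ` ?S)"
    proof
      fix z assume z: "z \<in> Fix I g"
      have "z = (\<Sum>i\<in>?S. (\<lambda>j. z i * e i j))"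
      proof
        fix j
        have "(\<Sum>i\<in>?S. z i * e i j) = (\<Sum>i\<in>?S. if j = i then z i else 0)"
          by (rule sum.cong) (auto simp: e_def)
        then show "z j = (\<Sum>i\<in>?S. (\<lambda>j. z i * e i j)) j"
          using z S by (simp add: app Fix affine_space_def)
      qed
      also have "\<dots> \<in> V.span (e ` ?S)"
        by (intro V.span_sum V.span_scale V.span_base) auto
      finally show "z \<in> V.span (e ` ?S)" .
    qed
    show "V.independent (e ` ?S)"
    proof (rule V.independent_if_scalars_zero)
      fix f v assume eq: "(\<Sum>x\<in>e ` ?S. (\<lambda>i. f x * x i)) = 0" and v: "v \<in> e ` ?S"
      then obtain j where j: "j \<in> ?S" "v = e j" by blast
      have "(\<Sum>i\<in>?S. f (e i) * e i j) = (\<Sum>x\<in>e ` ?S. (\<lambda>i. f x * x i)) j"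
        by (simp add: sum.reindex[OF inj] app)
      moreover have "(\<Sum>i\<in>?S. f (e i) * e i j) = (\<Sum>i\<in>?S. if j = i then f (e i) else 0)"
        by (rule sum.cong) (auto simp: e_def)
      ultimately show "f v = 0"
        using eq j S by simp
    qed (use S in simp)
  qed
  then show ?thesis
    by (simp add: fixed_dim_def card_image[OF inj])
qed

lemma sector_element_extensional: "sector_element I W H a g \<in> extensional H"
  by (simp add: sector_element_def)

lemma sector_element_in_state_space_iff:
  assumes H: "finite I" "\<And>h a. h \<in> H \<Longrightarrow> a \<in> keys W \<Longrightarrow> pairing a h \<in> \<int>" and g: "g \<in> H"
  shows "sector_element I W H a g \<in> carrier (state_space I W H)
    \<longleftrightarrow> jacobian_class I W g (monomial a) \<in> invariant_sector I W H g"
proof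
  assume "sector_element I W H a g \<in> carrier (state_space I W H)"
  from state_space_carrierD(2)[OF this g] g
  show "jacobian_class I W g (monomial a) \<in> invariant_sector I W H g"
    by (simp add: sector_element_def)
next
  assume C: "jacobian_class I W g (monomial a) \<in> invariant_sector I W H g"
  have "finite {g' \<in> H. sector_element I W H a g g' \<noteq> \<zero>\<^bsub>jacobian_ring I W g'\<^esub>}"
    by (rule finite_subset[of _ "{g}"]) (auto simp: sector_element_def)
  then show "sector_element I W H a g \<in> carrier (state_space I W H)"
    using C invariant_sector_zero[OF H]
    by (auto simp: state_space_carrier_iff PiE_iff sector_element_def)
qed

lemma sector_element_eq_zero:
  assumes "monomial a \<in> jacobian_ideal I W g"
  shows "sector_element I W H a g = \<zero>\<^bsub>state_space I W H\<^esub>"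
  by (rule state_space_eqI[OF sector_element_extensional state_space_extensional(1)])
    (use assms in \<open>auto simp: sector_element_def state_space_zero_apply jacobian_class_eq_zero_iff\<close>)

subsection \<open>The twist\<close>

locale twist =
  fixes n m :: nat and f1 f2 W1 W2 W W_tw :: "var mpoly"
    and I1 I2 I I_tw :: "var set" and G SG G_tw :: "(var \<Rightarrow> rat) set"
  assumes I1: "I1 = X ` {0..n}" and I2: "I2 = Y ` {0..m}" and I: "I = I1 \<union> I2"
    and f1: "f1 \<in> carrier (poly_ring (X ` {1..n}))"
    and f2: "f2 \<in> carrier (poly_ring (Y ` {1..m}))"
    and W1: "W1 = Var (X 0) ^ 2 + f1" and W2: "W2 = Var (Y 0) ^ 2 + f2" and W: "W = W1 + W2"
    and inv1: "invertible_poly I1 W1" and inv2: "invertible_poly I2 W2"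
    and cy1: "calabi_yau I1 W1" and cy2: "calabi_yau I2 W2"
    and G: "subgroup G (QZ I)"
    and JG: "Jgroup I1 W1 <#>\<^bsub>QZ I\<^esub> Jgroup I2 W2 \<subseteq> G"
    and GSL: "G \<subseteq> SL I1 W1 <#>\<^bsub>QZ I\<^esub> SL I2 W2"
    and SG: "SG = Sigma_group I G"
    and I_tw: "I_tw = X ` {1..n} \<union> Y ` {1..m}"
    and W_tw: "W_tw = f1 - f2"
    and G_tw: "G_tw = twist_group I_tw W_tw SG"
begin

section \<open>The monomials of \<open>W\<close> and \<open>W_tw\<close>\<close>

abbreviation "x0sq \<equiv> Poly_Mapping.single (X 0) (2::nat)"
abbreviation "y0sq \<equiv> Poly_Mapping.single (Y 0) (2::nat)"

lemma finite_I [simp]: "finite I" "finite I1" "finite I2" "finite I_tw"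
  by (simp_all add: I I1 I2 I_tw)

lemma X0_Y0 [simp]: "X 0 \<in> I" "Y 0 \<in> I" "X 0 \<notin> I_tw" "Y 0 \<notin> I_tw" "X 0 \<in> I1" "Y 0 \<in> I2"
  "X 0 \<notin> I2" "Y 0 \<notin> I1"
  by (auto simp: I I1 I2 I_tw)

lemma I_eq: "I = insert (X 0) (insert (Y 0) I_tw)"
  and I1_eq: "I1 = insert (X 0) (X ` {1..n})" and I2_eq: "I2 = insert (Y 0) (Y ` {1..m})"
proof -
  have *: "{0..k} = insert 0 {1..k}" for k :: nat by auto
  show "I = insert (X 0) (insert (Y 0) I_tw)" "I1 = insert (X 0) (X ` {1..n})"
    "I2 = insert (Y 0) (Y ` {1..m})"
    unfolding I I1 I2 I_tw * by auto
qed

lemma keys_f1: "a \<in> keys f1 \<Longrightarrow> keys a \<subseteq> X ` {1..n}"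
  and keys_f2: "a \<in> keys f2 \<Longrightarrow> keys a \<subseteq> Y ` {1..m}"
  using f1 f2 by (auto simp: carrier_poly_ring)

lemma coeff_W1: "coeff W1 a = (if a = x0sq then 1 else 0) + coeff f1 a"
  and coeff_W2: "coeff W2 a = (if a = y0sq then 1 else 0) + coeff f2 a"
  by (auto simp: W1 W2 Var_power lookup_add lookup_single when_def)

lemma x0sq_notin [simp]: "x0sq \<notin> keys f1" "x0sq \<notin> keys f2" "y0sq \<notin> keys f1" "y0sq \<notin> keys f2"
  using keys_f1[of x0sq] keys_f2[of x0sq] keys_f1[of y0sq] keys_f2[of y0sq] by auto

lemma keys_W1: "keys W1 = insert x0sq (keys f1)" and keys_W2: "keys W2 = insert y0sq (keys f2)"
  using x0sq_notin by (auto simp: in_keys_iff coeff_W1 coeff_W2 split: if_splits)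

lemma W1_carrier: "W1 \<in> carrier (poly_ring I1)" and W2_carrier: "W2 \<in> carrier (poly_ring I2)"
  using keys_f1 keys_f2 by (auto simp: carrier_poly_ring keys_W1 keys_W2 I1_eq I2_eq)

abbreviation "w1 \<equiv> weights I1 W1"
abbreviation "w2 \<equiv> weights I2 W2"

lemma ws1: "weight_system I1 W1 q \<longleftrightarrow> q = w1" and ws2: "weight_system I2 W2 q \<longleftrightarrow> q = w2"
proof -
  have "\<exists>!q. weight_system I1 W1 q" "\<exists>!q. weight_system I2 W2 q"
    using inv1 inv2 by (auto simp: invertible_poly_def nondegenerate_def)
  then show "weight_system I1 W1 q \<longleftrightarrow> q = w1" "weight_system I2 W2 q \<longleftrightarrow> q = w2"
    unfolding weights_def by (metis (mono_tags, lifting) theI')+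
qed

lemma w1: "i \<in> I1 \<Longrightarrow> w1 i > 0" "i \<notin> I1 \<Longrightarrow> w1 i = 0" "a \<in> keys W1 \<Longrightarrow> pairing a w1 = 1"
  and w2: "i \<in> I2 \<Longrightarrow> w2 i > 0" "i \<notin> I2 \<Longrightarrow> w2 i = 0" "a \<in> keys W2 \<Longrightarrow> pairing a w2 = 1"
  using ws1[of w1] ws2[of w2]
  by (simp_all add: weight_system_iff_pairing W1_carrier W2_carrier)

text \<open>A constant term would have weighted degree 0 instead of 1. The constant is the only
  monomial that polynomials in disjoint variables could share, so nothing cancels in
  \<open>f1 + f2\<close> or \<open>f1 - f2\<close>.\<close>

lemma zero_notin_keys [simp]: "0 \<notin> keys f1" "0 \<notin> keys f2"
  using w1(3)[of 0] w2(3)[of 0] by (auto simp: keys_W1 keys_W2 pairing_def)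

lemma keys_f_disjoint: "a \<in> keys f1 \<Longrightarrow> coeff f2 a = 0" "a \<in> keys f2 \<Longrightarrow> coeff f1 a = 0"
proof -
  have "a = 0" if "a \<in> keys f1" "a \<in> keys f2" for a
    using keys_f1[OF that(1)] keys_f2[OF that(2)] by (auto simp flip: keys_eq_empty)
  then show "a \<in> keys f1 \<Longrightarrow> coeff f2 a = 0" "a \<in> keys f2 \<Longrightarrow> coeff f1 a = 0"
    using zero_notin_keys by (metis in_keys_iff)+
qed

lemma coeff_W: "coeff W a = (if a = x0sq \<or> a = y0sq then 1 else 0) + coeff f1 a + coeff f2 a"
  by (auto simp: W lookup_add coeff_W1 coeff_W2 poly_mapping_eq_iff fun_eq_iff lookup_single when_def)

lemma keys_W: "keys W = insert x0sq (insert y0sq (keys f1 \<union> keys f2))"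
proof -
  have "coeff W a \<noteq> 0 \<longleftrightarrow> a = x0sq \<or> a = y0sq \<or> a \<in> keys f1 \<or> a \<in> keys f2" for a
    using x0sq_notin keys_f_disjoint[of a] by (auto simp: coeff_W in_keys_iff)
  then show ?thesis by (auto simp: in_keys_iff)
qed

lemma keys_W_tw: "keys W_tw = keys f1 \<union> keys f2"
proof -
  have "coeff W_tw a \<noteq> 0 \<longleftrightarrow> a \<in> keys f1 \<or> a \<in> keys f2" for a
    using keys_f_disjoint[of a] by (auto simp: W_tw lookup_minus in_keys_iff)
  then show ?thesis by (auto simp: in_keys_iff)
qed

lemma W_carrier: "W \<in> carrier (poly_ring I)"
  by (auto simp: carrier_poly_ring keys_W I_eq I_tw dest!: keys_f1 keys_f2)

lemma W_tw_carrier: "W_tw \<in> carrier (poly_ring I_tw)"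
  by (auto simp: carrier_poly_ring keys_W_tw I_tw dest!: keys_f1 keys_f2)

section \<open>Weights of \<open>W\<close> and \<open>W_tw\<close>, ages of the grading
  operators\<close>

definition w :: "var \<Rightarrow> rat" where "w i = w1 i + w2 i"

lemma I12_disjoint: "i \<in> I1 \<Longrightarrow> i \<notin> I2" "i \<in> I2 \<Longrightarrow> i \<notin> I1"
  by (auto simp: I1 I2)

lemma w_I1: "i \<in> I1 \<Longrightarrow> w i = w1 i" and w_I2: "i \<in> I2 \<Longrightarrow> w i = w2 i"
  by (simp_all add: w_def w1(2) w2(2) I12_disjoint)

lemma keys_W1_subset: "a \<in> keys W1 \<Longrightarrow> keys a \<subseteq> I1" and keys_W2_subset: "a \<in> keys W2 \<Longrightarrow> keys a \<subseteq> I2"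
  using W1_carrier W2_carrier by (auto simp: carrier_poly_ring)

lemma keys_W_eq: "keys W = keys W1 \<union> keys W2"
  by (auto simp: keys_W keys_W1 keys_W2)

lemma pairing_w: "a \<in> keys W \<Longrightarrow> pairing a w = 1"
proof -
  have "pairing a w = pairing a w1" if "a \<in> keys W1"
    using keys_W1_subset[OF that] by (intro pairing_cong) (auto simp: w_I1)
  moreover have "pairing a w = pairing a w2" if "a \<in> keys W2"
    using keys_W2_subset[OF that] by (intro pairing_cong) (auto simp: w_I2)
  ultimately show "a \<in> keys W \<Longrightarrow> pairing a w = 1"
    by (auto simp: keys_W_eq w1(3) w2(3))
qed

lemma w_0 [simp]: "w (X 0) = 1/2" "w (Y 0) = 1/2"
  using pairing_w[of x0sq] pairing_w[of y0sq] by (auto simp: keys_W)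

lemma w_pos: "i \<in> I \<Longrightarrow> w i > 0"
  by (auto simp: I w_I1 w_I2 w1(1) w2(1))

lemma w_unique:
  assumes pos: "\<And>i. i \<in> I \<Longrightarrow> q i > 0" and one: "\<And>a. a \<in> keys W \<Longrightarrow> pairing a q = 1" and i: "i \<in> I"
  shows "q i = w i"
proof -
  have "weight_system I1 W1 (\<lambda>i. if i \<in> I1 then q i else 0)"
    unfolding weight_system_iff_pairing[OF finite_I(2) W1_carrier]
  proof (intro conjI ballI)
    fix a assume a: "a \<in> keys W1"
    then have "pairing a (\<lambda>i. if i \<in> I1 then q i else 0) = pairing a q"
      using keys_W1_subset[OF a] by (intro pairing_cong) auto
    with one a show "pairing a (\<lambda>i. if i \<in> I1 then q i else 0) = 1" by (simp add: keys_W_eq)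
  qed (use pos in \<open>auto simp: I\<close>)
  moreover have "weight_system I2 W2 (\<lambda>i. if i \<in> I2 then q i else 0)"
    unfolding weight_system_iff_pairing[OF finite_I(3) W2_carrier]
  proof (intro conjI ballI)
    fix a assume a: "a \<in> keys W2"
    then have "pairing a (\<lambda>i. if i \<in> I2 then q i else 0) = pairing a q"
      using keys_W2_subset[OF a] by (intro pairing_cong) auto
    with one a show "pairing a (\<lambda>i. if i \<in> I2 then q i else 0) = 1" by (simp add: keys_W_eq)
  qed (use pos in \<open>auto simp: I\<close>)
  ultimately have e: "(\<lambda>i. if i \<in> I1 then q i else 0) = w1" "(\<lambda>i. if i \<in> I2 then q i else 0) = w2"
    by (simp_all only: ws1 ws2)
  have "w1 i = (if i \<in> I1 then q i else 0)" "w2 i = (if i \<in> I2 then q i else 0)"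
    by (rule fun_cong[OF e(1), symmetric], rule fun_cong[OF e(2), symmetric])
  with i show ?thesis by (auto simp: w_def I I12_disjoint)
qed

lemma w_outside: "i \<notin> I \<Longrightarrow> w i = 0"
  by (simp add: w_def w1(2) w2(2) I)

lemma weights_W: "weights I W = w"
proof (rule weights_eqI)
  show "weight_system I W w"
    by (simp add: weight_system_iff_pairing W_carrier w_pos pairing_w w_outside)
  fix q assume q: "weight_system I W q"
  show "q = w"
  proof
    fix i show "q i = w i"
      using q w_unique[of q i] w_outside[of i]
      by (cases "i \<in> I") (simp_all add: weight_system_iff_pairing W_carrier)
  qed
qed

lemma pairing_tw: "a \<in> keys W_tw \<Longrightarrow> (\<And>i. i \<in> I_tw \<Longrightarrow> h i = h' i) \<Longrightarrow> pairing a h = pairing a h'"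
  using W_tw_carrier by (intro pairing_cong) (auto simp: carrier_poly_ring)

lemma weights_W_tw: "weights I_tw W_tw = (\<lambda>i. if i \<in> I_tw then w i else 0)" (is "_ = ?w")
proof (rule weights_eqI)
  have "pairing a ?w = 1" if "a \<in> keys W_tw" for a
    using pairing_tw[OF that, of ?w w] pairing_w[of a] that by (auto simp: keys_W keys_W_tw)
  then show "weight_system I_tw W_tw ?w"
    using w_pos by (simp add: weight_system_iff_pairing W_tw_carrier I_eq)
  fix q assume q: "weight_system I_tw W_tw q"
  \<comment> \<open>The monomials \<open>x0sq\<close> and \<open>y0sq\<close> force the value 1/2.
    Filling it in turns a weight system of \<open>W_tw\<close> into one for \<open>W\<close>, where
    uniqueness is known.\<close>
  let ?q = "\<lambda>i. if i = X 0 \<or> i = Y 0 then 1/2 else q i"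
  have qpos: "\<And>i. i \<in> I_tw \<Longrightarrow> q i > 0" "\<And>i. i \<notin> I_tw \<Longrightarrow> q i = 0"
    and q1: "\<And>a. a \<in> keys W_tw \<Longrightarrow> pairing a q = 1"
    using q by (auto simp: weight_system_iff_pairing W_tw_carrier)
  have "?q i = w i" if "i \<in> I" for i
  proof (rule w_unique[OF _ _ that])
    show "?q i > 0" if "i \<in> I" for i
      using that qpos by (auto simp: I_eq)
    show "pairing a ?q = 1" if "a \<in> keys W" for a
    proof (cases "a \<in> keys W_tw")
      case True
      then have "pairing a ?q = pairing a q" by (rule pairing_tw) auto
      with q1[OF True] show ?thesis by simp
    qed (use that in \<open>auto simp: keys_W keys_W_tw\<close>)
  qed
  then have *: "(if i = X 0 \<or> i = Y 0 then 1/2 else q i) = w i" if "i \<in> I" for i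
    using that by blast
  show "q = ?w"
  proof
    fix i show "q i = ?w i"
      using *[of i] qpos(2)[of i] by (cases "i \<in> I_tw") (auto simp: I_eq split: if_splits)
  qed
qed

text \<open>Each block is Calabi-Yau, and the two removed variables have weight 1/2 each. In
  particular \<open>W_tw\<close> is Calabi-Yau again.\<close>

lemma sum_w: "sum w I1 = 1" "sum w I2 = 1" "sum w I = 2" "sum w I_tw = 1"
proof -
  show *: "sum w I1 = 1" "sum w I2 = 1"
    using cy1 cy2 by (simp_all add: calabi_yau_def w_I1 w_I2 cong: sum.cong)
  have "sum w I = sum w I1 + sum w I2"
    unfolding I by (rule sum.union_disjoint) (auto dest: I12_disjoint)
  with * show "sum w I = 2" by simp
  then show "sum w I_tw = 1" by (simp add: I_eq)
qed

text \<open>Each block has total weight 1 and already contains a variable of weight 1/2, and all its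
  weights are positive. Consequently the grading operators coincide with the weight vectors, without
  reduction modulo 1.\<close>

lemma w_less_1: "w i < 1"
proof -
  have *: "w i < 1" if "finite A" "A \<subseteq> I" "sum w A = 1" "j \<in> A" "w j = 1/2" "i \<in> A" for A j
  proof (cases "i = j")
    case False
    have "sum w {i, j} \<le> sum w A"
      using that w_pos by (intro sum_mono2) (auto intro: less_imp_le)
    with that False show ?thesis by simp
  qed (use that in simp)
  consider "i \<in> I1" | "i \<in> I2" | "i \<notin> I" by (auto simp: I)
  then show ?thesis
  proof cases
    case 1
    then show ?thesis by (intro *[of I1 "X 0"]) (auto simp: I sum_w)
  next
    case 2
    then show ?thesis by (intro *[of I2 "Y 0"]) (auto simp: I sum_w)
  qed (simp add: w_outside)
qed

lemma frac_w [simp]: "frac (w i) = w i"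
  using w_pos[of i] w_less_1[of i] w_outside[of i] by (cases "i \<in> I") (auto simp: frac_eq)

lemma age_grading_op: "age I (grading_op I W) = 2" "age I_tw (grading_op I_tw W_tw) = 1"
  by (simp_all add: age_def grading_op_def weights_W weights_W_tw sum_w)

section \<open>The groups \<open>SG\<close> and \<open>G_tw\<close>\<close>

text \<open>The involution has phase \<open>2 * (1/2)\<close> on the two squares and 0 on every
  other monomial. An element of \<open>G\<close> is a product of symmetries of \<open>W1\<close> and
  of \<open>W2\<close>, each of which is trivial on the block of the other.\<close>

lemma SG_subgroup: "subgroup SG (QZ I)"
  and twist_in_SG: "twist_involution \<in> SG"
  and SG_subset_Gmax: "SG \<subseteq> Gmax I W"
  and G_subset_SG: "G \<subseteq> SG"
proof -
  interpret group "QZ I" by (rule comm_group.axioms(2)[OF QZ_comm_group])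
  have tc: "twist_involution \<in> carrier (QZ I)"
    by (auto simp: twist_involution_def QZ_def)
  have gens: "insert twist_involution G \<subseteq> carrier (QZ I)"
    using tc subgroup.subset[OF G] by blast
  then show "subgroup SG (QZ I)"
    unfolding SG Sigma_group_def by (rule generate_is_subgroup)
  show "twist_involution \<in> SG" "G \<subseteq> SG"
    unfolding SG Sigma_group_def by (auto intro: generate.incl)
  have "pairing a twist_involution \<in> \<int>" if a: "a \<in> keys W" for a
  proof (cases "a \<in> keys W_tw")
    case True
    then have "pairing a twist_involution = pairing a (\<lambda>_. 0)"
      by (rule pairing_tw) (auto simp: twist_involution_def)
    then show ?thesis by (simp add: pairing_def)
  next
    case False
    with a show ?thesis by (auto simp: keys_W keys_W_tw twist_involution_def)
  qed
  then have "twist_involution \<in> Gmax I W" by (simp add: Gmax_iff tc)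
  moreover have "G \<subseteq> Gmax I W"
  proof
    fix g assume g: "g \<in> G"
    then obtain g1 g2 where g1: "g1 \<in> Gmax I1 W1" and g2: "g2 \<in> Gmax I2 W2"
      and eq: "g = (\<lambda>i. frac (g1 i + g2 i))"
      using GSL by (auto simp: set_mult_def SL_def)
    have "pairing a g1 + pairing a g2 \<in> \<int>" if "a \<in> keys W" for a
    proof (cases "a \<in> keys W1")
      case True
      have "pairing a g2 = pairing a (\<lambda>_. 0)"
        using g2 keys_W1_subset[OF True] I12_disjoint
        by (intro pairing_cong) (auto simp: Gmax_def QZ_def)
      with g1 True show ?thesis by (simp add: Gmax_iff) (simp add: pairing_def)
    next
      case False
      with that have a2: "a \<in> keys W2" by (auto simp: keys_W_eq)
      have "pairing a g1 = pairing a (\<lambda>_. 0)"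
        using g1 keys_W2_subset[OF a2] I12_disjoint
        by (intro pairing_cong) (auto simp: Gmax_def QZ_def)
      with g2 a2 show ?thesis by (simp add: Gmax_iff) (simp add: pairing_def)
    qed
    then show "g \<in> Gmax I W"
      using g subgroup.subset[OF G] by (auto simp: Gmax_iff eq pairing_QZ_mult)
  qed
  ultimately show "SG \<subseteq> Gmax I W"
    unfolding SG Sigma_group_def by (intro generate_subgroup_incl Gmax_subgroup) auto
qed

lemma SG_pairing: "h \<in> SG \<Longrightarrow> a \<in> keys W \<Longrightarrow> pairing a h \<in> \<int>"
  using SG_subset_Gmax by (auto simp: Gmax_iff)

lemma SG_pairing_tw: "h \<in> SG \<Longrightarrow> a \<in> keys W_tw \<Longrightarrow> pairing a h \<in> \<int>"
  using SG_pairing by (auto simp: keys_W keys_W_tw)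

lemma SG_carrier: "h \<in> SG \<Longrightarrow> h \<in> carrier (QZ I)"
  using subgroup.subset[OF SG_subgroup] by blast

lemma SG_mult: "g \<in> SG \<Longrightarrow> h \<in> SG \<Longrightarrow> (\<lambda>i. frac (g i + h i)) \<in> SG"
  using subgroup.m_closed[OF SG_subgroup] by simp

text \<open>Invariance of \<open>x0sq\<close> and \<open>y0sq\<close> makes \<open>2 * h i\<close>
  an integer in \<open>[0,2)\<close>.\<close>

lemma SG_half:
  assumes "h \<in> SG" and "i = X 0 \<or> i = Y 0"
  shows "h i = 0 \<or> h i = 1/2"
proof -
  have bounds: "0 \<le> h i" "h i < 1"
    using SG_carrier[OF assms(1)] assms(2) by (auto simp: QZ_def)
  have "2 * h i \<in> \<int>"
    using SG_pairing[OF assms(1), of x0sq] SG_pairing[OF assms(1), of y0sq] assms(2)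
    by (auto simp: keys_W)
  then obtain k :: int where k: "2 * h i = of_int k" by (auto elim: Ints_cases)
  with bounds have "0 \<le> (of_int k :: rat)" "(of_int k :: rat) < 2" by linarith+
  then have "k = 0 \<or> k = 1" by auto
  with k show ?thesis by auto
qed

text \<open>This is the operator \<open>j\<close>, obtained as its product with the neutral element
  of the second group. Of the two quadratic variables it moves only \<open>X 0\<close>, so it tells
  the two kinds of sectors apart, which the involution cannot do.\<close>

lemma w1_in_SG: "w1 \<in> SG"
proof -
  have frac_w1: "frac (w1 i) = w1 i" for i
    using frac_w[of i] by (cases "i \<in> I1") (auto simp: w_I1 w1(2))
  have "grading_op I1 W1 \<in> Jgroup I1 W1"
    unfolding Jgroup_def by (rule generate.incl) simp
  moreover have "(\<lambda>_. 0) \<in> Jgroup I2 W2"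
    unfolding Jgroup_def using generate.one[of "QZ I2"] by simp
  ultimately have "(\<lambda>i. frac (grading_op I1 W1 i + 0)) \<in> Jgroup I1 W1 <#>\<^bsub>QZ I\<^esub> Jgroup I2 W2"
    unfolding set_mult_def by force
  then have "w1 \<in> Jgroup I1 W1 <#>\<^bsub>QZ I\<^esub> Jgroup I2 W2"
    by (simp add: grading_op_def frac_w1)
  then show ?thesis using JG G_subset_SG by blast
qed

lemma w1_0 [simp]: "w1 (X 0) = 1/2" "w1 (Y 0) = 0"
  using w_I1[of "X 0"] by (simp_all add: w1(2))

text \<open>Every monomial of \<open>W_tw\<close> is a monomial of \<open>W\<close>, so for members
  of \<open>SG\<close> the symmetry condition is automatic and only the support in
  \<open>I_tw\<close> remains.\<close>

lemma G_tw_iff: "h \<in> G_tw \<longleftrightarrow> h \<in> SG \<and> h (X 0) = 0 \<and> h (Y 0) = 0"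
proof -
  have "h \<in> Gmax I_tw W_tw \<longleftrightarrow> h (X 0) = 0 \<and> h (Y 0) = 0" if "h \<in> SG"
    using SG_carrier[OF that] SG_pairing_tw[OF that] by (auto simp: Gmax_iff QZ_def I_eq) metis
  then show ?thesis by (auto simp: G_tw twist_group_def)
qed

section \<open>Comparison of the Jacobian ideals of \<open>W\<close> and \<open>W_tw\<close>\<close>

abbreviation "F \<equiv> fixed_vars I"
abbreviation "S \<equiv> fixed_vars I_tw"
abbreviation "J \<equiv> jacobian_ideal I W"
abbreviation "J' \<equiv> jacobian_ideal I_tw W_tw"
abbreviation "cls \<equiv> jacobian_class I W"
abbreviation "cls' \<equiv> jacobian_class I_tw W_tw"

lemma S_subset: "S g \<subseteq> F g" "S g \<subseteq> I_tw"
  by (auto simp: fixed_vars_def I_eq)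

lemma F_minus_S: "F g - S g = {i \<in> {X 0, Y 0}. g i = 0}"
  by (auto simp: fixed_vars_def I_eq)

text \<open>One variable occurring in a monomial decides to which of the four summands of
  \<open>W\<close> it can belong.\<close>

lemma coeff_f_cases:
  assumes "i \<in> keys b"
  shows "i \<in> X ` {1..n} \<Longrightarrow> coeff W b = coeff W_tw b"
    and "i \<in> Y ` {1..m} \<Longrightarrow> coeff W b = - coeff W_tw b"
    and "i = X 0 \<Longrightarrow> coeff W b = (if b = x0sq then 1 else 0)"
    and "i = Y 0 \<Longrightarrow> coeff W b = (if b = y0sq then 1 else 0)"
proof -
  have f1: "coeff f1 b = 0" if "i \<notin> X ` {1..n}"
    using keys_f1[of b] assms that by (metis in_keys_iff subsetD)
  have f2: "coeff f2 b = 0" if "i \<notin> Y ` {1..m}"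
    using keys_f2[of b] assms that by (metis in_keys_iff subsetD)
  have ne: "b \<noteq> x0sq" if "i \<noteq> X 0" using assms that by auto
  have ne': "b \<noteq> y0sq" if "i \<noteq> Y 0" using assms that by auto
  have n0: "X 0 \<notin> X ` {1..n}" "X 0 \<notin> Y ` {1..m}" "Y 0 \<notin> X ` {1..n}" "Y 0 \<notin> Y ` {1..m}"
    by auto
  show "i \<in> X ` {1..n} \<Longrightarrow> coeff W b = coeff W_tw b"
    using f2 ne ne' by (auto simp: coeff_W W_tw lookup_minus)
  show "i \<in> Y ` {1..m} \<Longrightarrow> coeff W b = - coeff W_tw b"
    using f1 ne ne' by (auto simp: coeff_W W_tw lookup_minus)
  show "i = X 0 \<Longrightarrow> coeff W b = (if b = x0sq then 1 else 0)"
    using f1 f2 ne' n0 by (auto simp: coeff_W)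
  show "i = Y 0 \<Longrightarrow> coeff W b = (if b = y0sq then 1 else 0)"
    using f1 f2 ne n0 by (auto simp: coeff_W)
qed

text \<open>The sign \<open>e\<close> is 1 for the variables of \<open>f1\<close> and -1 for those
  of \<open>f2\<close>. It is its own inverse, which makes the relation usable in both
  directions.\<close>

lemma pdiff_W:
  assumes "i \<in> S g"
  obtains e where "e * e = (1 :: complex)"
    "pdiff i (restrict_poly (F g) W) = Const e * pdiff i (restrict_poly (S g) W_tw)"
proof -
  define e :: complex where "e = (if i \<in> X ` {1..n} then 1 else - 1)"
  have i: "i \<in> X ` {1..n} \<or> i \<in> Y ` {1..m}"
    using assms S_subset(2)[of g] by (auto simp: I_tw)
  have "pdiff i (restrict_poly (F g) W) = Const e * pdiff i (restrict_poly (S g) W_tw)"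
  proof (rule poly_mapping_eqI)
    fix a
    let ?b = "a + Poly_Mapping.single i (1::nat)"
    have ib: "i \<in> keys ?b" by (simp add: keys_add_nat)
    have "coeff W ?b = e * coeff W_tw ?b"
      using coeff_f_cases(1,2)[OF ib] i by (auto simp: e_def)
    moreover have "keys ?b \<subseteq> F g \<longleftrightarrow> keys ?b \<subseteq> S g" if "coeff W_tw ?b \<noteq> 0"
      using W_tw_carrier that by (auto simp: in_poly_ring_iff fixed_vars_def I_eq)
    ultimately show "coeff (pdiff i (restrict_poly (F g) W)) a
        = coeff (Const e * pdiff i (restrict_poly (S g) W_tw)) a"
      by (auto simp: coeff_pdiff coeff_restrict_poly)
  qed
  moreover have "e * e = 1" by (simp add: e_def)
  ultimately show ?thesis using that by blast
qed

lemma pdiff_W_quadratic: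
  assumes "i \<in> F g - S g"
  shows "pdiff i (restrict_poly (F g) W) = Const 2 * Var i"
proof (rule poly_mapping_eqI)
  fix a
  let ?e = "Poly_Mapping.single i (1::nat)"
  have i: "i \<in> F g" "i = X 0 \<or> i = Y 0" using assms F_minus_S by blast+
  have ib: "i \<in> keys (a + ?e)" by (simp add: keys_add_nat)
  have two: "Poly_Mapping.single i (2::nat) = ?e + ?e"
    by (simp add: single_add[symmetric] numeral_2_eq_2)
  have "coeff W (a + ?e) = (if a = ?e then 1 else 0)"
    using coeff_f_cases(3,4)[OF ib] i two by auto
  moreover have "keys (?e + ?e) \<subseteq> F g" using i by (simp add: keys_add_nat)
  ultimately show "coeff (pdiff i (restrict_poly (F g) W)) a = coeff (Const 2 * Var i) a"
    by (auto simp: coeff_pdiff coeff_restrict_poly Var_def monomial_def lookup_single when_def)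
qed

text \<open>Restriction kills the derivatives by \<open>X 0\<close> and \<open>Y 0\<close>, which
  are twice the variable, and fixes the other generators, which are those of \<open>J'\<close> up to
  sign; being multiplicative, it respects multiples.\<close>

lemma restrict_J: "p \<in> J g \<Longrightarrow> restrict_poly (S g) p \<in> J' g"
proof (induction rule: jacobian_ideal_induct)
  case (gen i)
  show ?case
  proof (cases "i \<in> S g")
    case True
    then obtain e where "pdiff i (restrict_poly (F g) W) = Const e * pdiff i (restrict_poly (S g) W_tw)"
      by (rule pdiff_W)
    with True show ?thesis
      by (simp add: restrict_poly_Const_mult restrict_poly_ident poly_ring_pdiff_restrict
          jacobian_ideal_Const_mult jacobian_ideal_gen)
  next
    case False
    with gen have "i \<in> F g - S g" by blast
    with False show ?thesis
      by (simp add: pdiff_W_quadratic restrict_poly_Const_mult restrict_poly_Var)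
  qed
next
  case (add p q)
  then show ?case by (auto simp: restrict_poly_add)
next
  case (mult r p)
  then show ?case by (auto simp: restrict_poly_mult)
qed simp

lemma J'_subset_J: "p \<in> J' g \<Longrightarrow> p \<in> J g"
proof (induction rule: jacobian_ideal_induct)
  case (gen i)
  then obtain e where e: "e * e = 1"
    and eq: "pdiff i (restrict_poly (F g) W) = Const e * pdiff i (restrict_poly (S g) W_tw)"
    by (rule pdiff_W)
  have "Const e * pdiff i (restrict_poly (F g) W) = pdiff i (restrict_poly (S g) W_tw)"
    unfolding eq
    by (rule poly_mapping_eqI, simp only: coeff_Const_mult, simp add: e mult.assoc[symmetric])
  moreover have "Const e * pdiff i (restrict_poly (F g) W) \<in> J g"
    using gen S_subset(1) by (intro jacobian_ideal_Const_mult jacobian_ideal_gen) auto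
  ultimately show ?case by simp
next
  case (mult r p)
  then show ?case using poly_ring_mono[OF S_subset(1)] by auto
qed auto

lemma Var_in_J:
  assumes "i \<in> F g - S g"
  shows "Var i \<in> J g"
proof -
  have "Const (1/2) * pdiff i (restrict_poly (F g) W) \<in> J g"
    using assms by (intro jacobian_ideal_Const_mult jacobian_ideal_gen) auto
  moreover have "Const (1/2) * (Const 2 * Var i) = Var i"
    by (rule poly_mapping_eqI) simp
  ultimately show ?thesis using assms by (simp add: pdiff_W_quadratic)
qed

text \<open>Every term dropped by the restriction is divisible by a fixed variable among
  \<open>X 0\<close> and \<open>Y 0\<close>, and such a variable lies in the ideal as half of a
  derivative.\<close>

lemma diff_restrict_in_J:
  assumes p: "p \<in> carrier (poly_ring (F g))"
  shows "p - restrict_poly (S g) p \<in> J g"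
proof -
  have "p - restrict_poly (S g) p
      = (\<Sum>a\<in>{a \<in> keys p. \<not> keys a \<subseteq> S g}. Poly_Mapping.single a (coeff p a))"
    by (rule poly_mapping_eqI)
      (auto simp: lookup_minus coeff_restrict_poly lookup_sum lookup_single when_def in_keys_iff)
  also have "\<dots> \<in> J g"
  proof (rule jacobian_ideal_sum)
    fix a assume a: "a \<in> {a \<in> keys p. \<not> keys a \<subseteq> S g}"
    then have aF: "keys a \<subseteq> F g" using p by (auto simp: carrier_poly_ring)
    with a obtain i where i: "i \<in> keys a" "i \<in> F g - S g" by blast
    let ?e = "Poly_Mapping.single i (1::nat)"
    have "a = (a - ?e) + ?e"
      using i(1) by (auto simp: poly_mapping_eq_iff fun_eq_iff lookup_add lookup_minus lookup_single
          when_def in_keys_iff)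
    then have "Poly_Mapping.single a (coeff p a) = Poly_Mapping.single (a - ?e) (coeff p a) * Var i"
      unfolding Var_def monomial_def mult_single by (metis mult.right_neutral)
    moreover have "keys (a - ?e) \<subseteq> keys a"
      by (auto simp: in_keys_iff lookup_minus)
    then have "Poly_Mapping.single (a - ?e) (coeff p a) \<in> carrier (poly_ring (F g))"
      using aF by (auto simp: carrier_poly_ring)
    ultimately show "Poly_Mapping.single a (coeff p a) \<in> J g"
      using Var_in_J[OF i(2)] by auto
  qed
  finally show ?thesis .
qed

text \<open>With \<open>diff_restrict_in_J\<close> this is the isomorphism of Jacobian rings: the
  inclusion of \<open>poly_ring (S g)\<close> is injective modulo the ideals by this equivalence and
  surjective by that lemma.\<close>

lemma in_J_iff: "p \<in> carrier (poly_ring (S g)) \<Longrightarrow> p \<in> J g \<longleftrightarrow> p \<in> J' g"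
  using restrict_J[of p g] J'_subset_J[of p g] by (auto simp: restrict_poly_ident)

text \<open>Restriction maps \<open>J g\<close> onto \<open>J' g\<close>, so the image of a class,
  taken as a set of polynomials, is a full class of the twisted ring.\<close>

lemma restrict_cls: "restrict_poly (S g) ` cls g p = cls' g (restrict_poly (S g) p)"
proof -
  have "restrict_poly (S g) ` J g = J' g"
  proof
    show "J' g \<subseteq> restrict_poly (S g) ` J g"
      using J'_subset_J jacobian_ideal_subset restrict_poly_ident by (metis image_eqI subsetI)
  qed (use restrict_J in blast)
  moreover have "restrict_poly (S g) ` (\<lambda>j. j + p) ` A
      = (\<lambda>j. j + restrict_poly (S g) p) ` restrict_poly (S g) ` A" for A
    by (simp add: image_image restrict_poly_add)
  ultimately show ?thesis by (simp add: jacobian_class_eq)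
qed

section \<open>The group action on sectors\<close>

text \<open>The character by which \<open>h\<close> acts on the part of the volume form lost in the
  twist, the product of those of \<open>dx0\<close> and \<open>dy0\<close> that are fixed by
  \<open>g\<close>.\<close>

definition quad_char :: "(var \<Rightarrow> rat) \<Rightarrow> (var \<Rightarrow> rat) \<Rightarrow> complex" where
  "quad_char g h = e2pi (\<Sum>i\<in>F g - S g. h i)"

text \<open>Since \<open>p\<close> does not involve \<open>X 0\<close> and \<open>Y 0\<close>, only
  the \<open>+ 1\<close> of the volume form survives on these variables.\<close>

lemma form_action_F:
  assumes "p \<in> carrier (poly_ring (S g))"
  shows "form_action (F g) h p = Const (quad_char g h) * form_action (S g) h p"
proof (rule poly_mapping_eqI)
  fix a
  have "e2pi (\<Sum>i\<in>F g. (of_nat (coeff a i) + 1) * h i)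
      = quad_char g h * e2pi (\<Sum>i\<in>S g. (of_nat (coeff a i) + 1) * h i)" if a: "keys a \<subseteq> S g"
  proof -
    have "(\<Sum>i\<in>F g. (of_nat (coeff a i) + 1) * h i)
        = (\<Sum>i\<in>F g - S g. (of_nat (coeff a i) + 1) * h i) + (\<Sum>i\<in>S g. (of_nat (coeff a i) + 1) * h i)"
      by (rule sum.subset_diff[OF S_subset(1)]) (simp add: fixed_vars_def)
    also have "(\<Sum>i\<in>F g - S g. (of_nat (coeff a i) + 1) * h i) = (\<Sum>i\<in>F g - S g. h i)"
    proof (rule sum.cong[OF refl])
      fix i assume "i \<in> F g - S g"
      with a have "coeff a i = 0" by (metis DiffD2 in_keys_iff subsetD)
      then show "(of_nat (coeff a i) + 1) * h i = h i" by simp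
    qed
    finally show ?thesis by (simp add: e2pi_add quad_char_def)
  qed
  then show "coeff (form_action (F g) h p) a = coeff (Const (quad_char g h) * form_action (S g) h p) a"
    using assms by (cases "coeff p a = 0") (auto simp: coeff_form_action in_poly_ring_iff)
qed

lemma sector_iff:
  assumes "p \<in> carrier (poly_ring (S g))"
  shows "cls g p \<in> invariant_sector I W SG g
    \<longleftrightarrow> (\<forall>h\<in>SG. Const (quad_char g h) * form_action (S g) h p - p \<in> J' g)"
proof -
  have "Const (quad_char g h) * form_action (S g) h p - p \<in> carrier (poly_ring (S g))" for h
    using assms by auto
  then show ?thesis
    using poly_ring_mono[OF S_subset(1) assms]
    by (simp add: jacobian_class_invariant_iff[OF finite_I(1) SG_pairing] form_action_F[OF assms] in_J_iff)
qed

lemma sectorE: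
  assumes "C \<in> invariant_sector I W SG g"
  obtains p where "p \<in> carrier (poly_ring (S g))" "C = cls g p"
proof -
  obtain p where p: "p \<in> carrier (poly_ring (F g))" "C = cls g p"
    using assms by (rule invariant_sectorE)
  then have "C = cls g (restrict_poly (S g) p)"
    by (simp add: jacobian_class_eq_iff diff_restrict_in_J)
  with that show ?thesis by blast
qed

lemma tw_sector_iff:
  assumes "p \<in> carrier (poly_ring (S g))"
  shows "cls' g p \<in> invariant_sector I_tw W_tw G_tw g
    \<longleftrightarrow> (\<forall>h\<in>G_tw. form_action (S g) h p - p \<in> J' g)"
  by (rule jacobian_class_invariant_iff[OF finite_I(4) _ assms]) (auto simp: G_tw_iff SG_pairing_tw)

lemma form_action_J': "h \<in> SG \<Longrightarrow> p \<in> J' g \<Longrightarrow> form_action (S g) h p \<in> J' g"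
  by (rule form_action_jacobian_ideal) (auto simp: SG_pairing_tw)

text \<open>\<open>SG\<close> is generated by \<open>G_tw\<close>, the involution and \<open>w1\<close>, the grading operator of \<open>W1\<close>;
  the involution is invisible on the variables of \<open>W_tw\<close>.\<close>

lemma SG_decomposition:
  assumes h: "h \<in> SG"
  obtains k where "k \<in> G_tw"
    "\<And>i. i \<in> I_tw \<Longrightarrow> h i - (k i + (if h (X 0) = h (Y 0) then 0 else w1 i)) \<in> \<int>"
proof -
  have frac_eqs: "frac (1/2 :: rat) = 1/2" "frac (- (1/2) :: rat) = 1/2" "frac (1::rat) = 0" "frac (0::rat) = 0"
    unfolding frac_unique_iff by simp_all
  define v1 where "v1 = (\<lambda>i. frac (- w1 i))"
  have v1: "v1 \<in> SG"
    using subgroup.m_inv_closed[OF SG_subgroup w1_in_SG]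
    by (simp add: QZ_inv SG_carrier w1_in_SG v1_def)
  define v2 where "v2 = (\<lambda>i. frac (v1 i + twist_involution i))"
  have v2: "v2 \<in> SG"
    using SG_mult[OF v1 twist_in_SG] by (simp add: v2_def)
  have zero: "(\<lambda>_. 0) \<in> SG"
    using subgroup.one_closed[OF SG_subgroup] by simp
  have vals: "v1 (X 0) = 1/2" "v1 (Y 0) = 0" "v2 (X 0) = 0" "v2 (Y 0) = 1/2"
    "twist_involution (X 0) = 1/2" "twist_involution (Y 0) = 1/2"
    by (simp_all add: v1_def v2_def twist_involution_def frac_eqs)
  have t0: "twist_involution i = 0" if "i \<in> I_tw" for i
    using that by (auto simp: twist_involution_def)
  \<comment> \<open>The corrector \<open>v\<close> is the neutral element, the involution, the
    inverse of \<open>w1\<close>, or the product of the last two, according to the four possible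
    pairs \<open>(h (X 0), h (Y 0))\<close>; it brings \<open>h\<close> into
    \<open>G_tw\<close>.\<close>
  have *: "\<exists>v\<in>SG. frac (h (X 0) + v (X 0)) = 0 \<and> frac (h (Y 0) + v (Y 0)) = 0
      \<and> (\<forall>i\<in>I_tw. v i + (if h (X 0) = h (Y 0) then 0 else w1 i) \<in> \<int>)"
  proof -
    have w1v: "v1 i + w1 i \<in> \<int>" for i
      by (simp add: v1_def frac_def)
    then have w1v': "v2 i + w1 i \<in> \<int>" if "i \<in> I_tw" for i
      using that by (simp add: v2_def v1_def t0)
    consider "h (X 0) = 0" "h (Y 0) = 0" | "h (X 0) = 1/2" "h (Y 0) = 1/2"
      | "h (X 0) = 1/2" "h (Y 0) = 0" | "h (X 0) = 0" "h (Y 0) = 1/2"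
      using SG_half[OF h] by metis
    then show ?thesis
    proof cases
      case 1 then show ?thesis by (intro bexI[OF _ zero]) (simp_all only: 1, auto simp: frac_eqs)
    next
      case 2 then show ?thesis by (intro bexI[OF _ twist_in_SG]) (simp_all only: 2, auto simp: frac_eqs vals t0)
    next
      case 3 then show ?thesis by (intro bexI[OF _ v1]) (simp_all only: 3, auto simp: frac_eqs vals w1v)
    next
      case 4 then show ?thesis by (intro bexI[OF _ v2]) (simp_all only: 4, auto simp: frac_eqs vals w1v')
    qed
  qed
  then obtain v where v: "v \<in> SG" "frac (h (X 0) + v (X 0)) = 0" "frac (h (Y 0) + v (Y 0)) = 0"
    and vw: "\<And>i. i \<in> I_tw \<Longrightarrow> v i + (if h (X 0) = h (Y 0) then 0 else w1 i) \<in> \<int>"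
    by blast
  define k where "k = (\<lambda>i. frac (h i + v i))"
  have "k \<in> G_tw"
    using SG_mult[OF h v(1)] v(2,3) by (simp add: G_tw_iff k_def)
  moreover have "h i - (k i + (if h (X 0) = h (Y 0) then 0 else w1 i)) \<in> \<int>" if "i \<in> I_tw" for i
  proof -
    have "h i - (k i + (if h (X 0) = h (Y 0) then 0 else w1 i))
        = of_int \<lfloor>h i + v i\<rfloor> - (v i + (if h (X 0) = h (Y 0) then 0 else w1 i))"
      by (simp add: k_def frac_def)
    with vw[OF that] show ?thesis by (simp only: Ints_diff Ints_of_int)
  qed
  ultimately show ?thesis using that by blast
qed

text \<open>By the decomposition, one condition for \<open>w1\<close> accounts for all of
  \<open>SG\<close> outside \<open>G_tw\<close>. The constant \<open>e\<close> keeps both cases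
  together: it is -1 in the sector of \<open>k\<close> and 1 in that of
  \<open>twisted k\<close>.\<close>

lemma SG_invariant_iff:
  "(\<forall>h\<in>SG. Const (if h (X 0) = h (Y 0) then 1 else e) * form_action (S g) h p - p \<in> J' g)
    \<longleftrightarrow> (\<forall>h\<in>G_tw. form_action (S g) h p - p \<in> J' g) \<and> Const e * form_action (S g) w1 p - p \<in> J' g"
  (is "?L \<longleftrightarrow> ?R")
proof
  assume L: ?L
  have "form_action (S g) h p - p \<in> J' g" if "h \<in> G_tw" for h
    using L[rule_format, of h] that by (simp add: G_tw_iff)
  moreover have "Const e * form_action (S g) w1 p - p \<in> J' g"
    using L[rule_format, OF w1_in_SG] by simp
  ultimately show ?R by blast
next
  assume R: ?R
  show ?L
  proof
    fix h assume h: "h \<in> SG"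
    obtain k where k: "k \<in> G_tw"
      and hk: "\<And>i. i \<in> I_tw \<Longrightarrow> h i - (k i + (if h (X 0) = h (Y 0) then 0 else w1 i)) \<in> \<int>"
      using SG_decomposition[OF h] by blast
    have fa: "form_action (S g) h p
        = form_action (S g) (\<lambda>i. k i + (if h (X 0) = h (Y 0) then 0 else w1 i)) p"
      by (rule form_action_cong_Ints) (use hk S_subset(2) in blast)
    have kp: "form_action (S g) k p - p \<in> J' g" using R k by blast
    show "Const (if h (X 0) = h (Y 0) then 1 else e) * form_action (S g) h p - p \<in> J' g"
    proof (cases "h (X 0) = h (Y 0)")
      case True
      with kp fa show ?thesis by simp
    next
      case False
      then have fa': "form_action (S g) h p = form_action (S g) k (form_action (S g) w1 p)"
        using fa by (simp add: form_action_compose)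
      \<comment> \<open>The relation for \<open>w1\<close> is moved by \<open>k\<close>, which
        preserves the ideal; afterwards \<open>kp\<close> replaces the moved \<open>p\<close> by
        \<open>p\<close>.\<close>
      have "form_action (S g) k (Const e * form_action (S g) w1 p - p) \<in> J' g"
        using R k by (intro form_action_J') (auto simp: G_tw_iff)
      then have "Const e * form_action (S g) h p - form_action (S g) k p \<in> J' g"
        by (simp add: form_action_diff form_action_Const_mult fa')
      from jacobian_ideal_add[OF this kp] False show ?thesis by simp
    qed
  qed
qed

section \<open>Invariant sectors of \<open>k\<close>, of \<open>twisted k\<close>, and the mixed
  ones\<close>

text \<open>For \<open>k\<close> in \<open>G_tw\<close> this is its product with the involution;
  overwriting two entries spares the reduction by \<open>frac\<close>.\<close>

definition twisted :: "(var \<Rightarrow> rat) \<Rightarrow> var \<Rightarrow> rat" where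
  "twisted k = (\<lambda>i. if i = X 0 \<or> i = Y 0 then 1/2 else k i)"

definition untwisted :: "(var \<Rightarrow> rat) \<Rightarrow> var \<Rightarrow> rat" where
  "untwisted k = (\<lambda>i. if i = X 0 \<or> i = Y 0 then 0 else k i)"

lemma frac_SG: "g \<in> SG \<Longrightarrow> frac (g i) = g i"
  using SG_carrier[of g] by (cases "i \<in> I") (auto simp: QZ_def frac_eq)

lemma frac_half [simp]: "frac (1/2 :: rat) = 1/2" "frac (1 :: rat) = 0"
  unfolding frac_unique_iff by simp_all

lemma twisted_in_SG: "k \<in> G_tw \<Longrightarrow> twisted k \<in> SG"
proof -
  assume k: "k \<in> G_tw"
  then have "twisted k = (\<lambda>i. frac (k i + twist_involution i))"
    by (auto simp: twisted_def twist_involution_def G_tw_iff frac_SG fun_eq_iff)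
  then show ?thesis
    using SG_mult[OF _ twist_in_SG, of k] k by (simp add: G_tw_iff)
qed

lemma untwisted_in_G_tw: "g \<in> SG \<Longrightarrow> g (X 0) = 1/2 \<Longrightarrow> g (Y 0) = 1/2 \<Longrightarrow> untwisted g \<in> G_tw"
proof -
  assume g: "g \<in> SG" "g (X 0) = 1/2" "g (Y 0) = 1/2"
  have "untwisted g i = frac (g i + twist_involution i)" for i
  proof (cases "i = X 0 \<or> i = Y 0")
    case True
    with g have "g i + twist_involution i = 1" by (auto simp: twist_involution_def)
    with True show ?thesis by (simp add: untwisted_def)
  qed (simp add: untwisted_def twist_involution_def frac_SG g)
  then have "untwisted g = (\<lambda>i. frac (g i + twist_involution i))" ..
  then have "untwisted g \<in> SG"
    using SG_mult[OF g(1) twist_in_SG] by simp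
  then show ?thesis by (simp add: G_tw_iff untwisted_def)
qed

lemma twisted_untwisted: "g (X 0) = 1/2 \<Longrightarrow> g (Y 0) = 1/2 \<Longrightarrow> twisted (untwisted g) = g"
  by (auto simp: twisted_def untwisted_def)

lemma untwisted_twisted: "k \<in> G_tw \<Longrightarrow> untwisted (twisted k) = k"
  by (auto simp: twisted_def untwisted_def G_tw_iff)

lemma twisted_0 [simp]: "twisted k (X 0) = 1/2" "twisted k (Y 0) = 1/2"
  by (simp_all add: twisted_def)

text \<open>The contributions of \<open>k\<close> and \<open>twisted k\<close> can be added because
  both live in the Jacobian ring of \<open>W_tw\<close> at \<open>k\<close>: only the fixed
  variables in \<open>I_tw\<close> enter.\<close>

lemma S_twisted [simp]: "S (twisted k) = S k"
  by (auto simp: fixed_vars_def twisted_def)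

lemma J'_twisted [simp]: "J' (twisted k) = J' k"
  by (simp add: jacobian_ideal_def)

lemma cls'_twisted [simp]: "cls' (twisted k) = cls' k"
  by (simp add: jacobian_class_def fun_eq_iff)

lemma G_tw_SG: "k \<in> G_tw \<Longrightarrow> k \<in> SG"
  by (simp add: G_tw_iff)

lemma SG_cases:
  assumes "g \<in> SG"
  obtains (fixed) "g \<in> G_tw" | (moved) "g (X 0) = 1/2" "g (Y 0) = 1/2" "untwisted g \<in> G_tw" "g = twisted (untwisted g)"
    | (mixed) "g (X 0) \<noteq> g (Y 0)"
  using SG_half[OF assms, of "X 0"] SG_half[OF assms, of "Y 0"] untwisted_in_G_tw[OF assms]
    twisted_untwisted[of g] assms by (auto simp: G_tw_iff)

text \<open>Both quadratic variables are fixed, and \<open>h\<close> acts on \<open>dx0\<close> and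
  on \<open>dy0\<close> by a sign each. For the involution the two signs cancel.\<close>

lemma quad_char_G_tw:
  assumes "k \<in> G_tw" "h \<in> SG"
  shows "quad_char k h = (if h (X 0) = h (Y 0) then 1 else - 1)"
proof -
  have "F k - S k = {X 0, Y 0}" using assms by (auto simp: F_minus_S G_tw_iff)
  then have qc: "quad_char k h = e2pi (h (X 0) + h (Y 0))" by (simp add: quad_char_def)
  consider "h (X 0) = 0" "h (Y 0) = 0" | "h (X 0) = 1/2" "h (Y 0) = 1/2"
    | "h (X 0) = 1/2" "h (Y 0) = 0" | "h (X 0) = 0" "h (Y 0) = 1/2"
    using SG_half[OF assms(2)] by metis
  then show ?thesis
    by cases (simp_all only: qc, simp_all add: e2pi_eq_1_iff)
qed

lemma quad_char_twisted: "quad_char (twisted k) h = 1"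
proof -
  have "F (twisted k) - S (twisted k) = {}" unfolding F_minus_S by auto
  then show ?thesis by (simp only: quad_char_def sum.empty e2pi_0)
qed

lemma sector_G_tw_iff:
  assumes "k \<in> G_tw" "p \<in> carrier (poly_ring (S k))"
  shows "cls k p \<in> invariant_sector I W SG k \<longleftrightarrow>
    (\<forall>h\<in>G_tw. form_action (S k) h p - p \<in> J' k) \<and> Const (- 1) * form_action (S k) w1 p - p \<in> J' k"
  unfolding sector_iff[OF assms(2)] SG_invariant_iff[symmetric]
  by (simp add: quad_char_G_tw[OF assms(1)])

lemma sector_twisted_iff:
  assumes "p \<in> carrier (poly_ring (S k))"
  shows "cls (twisted k) p \<in> invariant_sector I W SG (twisted k) \<longleftrightarrow>
    (\<forall>h\<in>G_tw. form_action (S k) h p - p \<in> J' k) \<and> Const 1 * form_action (S k) w1 p - p \<in> J' k"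
  unfolding SG_invariant_iff[symmetric]
  using sector_iff[of p "twisted k"] assms by (simp add: quad_char_twisted)

lemma half_in_J': "p + p \<in> J' k \<Longrightarrow> p \<in> J' k"
proof -
  assume "p + p \<in> J' k"
  then have "Const (1/2) * (p + p) \<in> J' k" by (rule jacobian_ideal_Const_mult)
  moreover have "Const (1/2) * (p + p) = p"
    by (rule poly_mapping_eqI) (simp only: coeff_Const_mult lookup_add, simp)
  ultimately show ?thesis by (simp only:)
qed

text \<open>When just one of the two quadratic variables is fixed, the involution acts by \<open>-1\<close> on the form
  and trivially on the other variables, so nothing is invariant.\<close>

lemma sector_mixed:
  assumes g: "g \<in> SG" "g (X 0) \<noteq> g (Y 0)" and C: "C \<in> invariant_sector I W SG g"
  shows "C = \<zero>\<^bsub>jacobian_ring I W g\<^esub>"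
proof -
  obtain p where p: "p \<in> carrier (poly_ring (S g))" "C = cls g p"
    using C by (rule sectorE)
  have "(g (X 0) = 0) \<noteq> (g (Y 0) = 0)"
  proof -
    have "g (X 0) = 0 \<or> g (X 0) = 1/2" "g (Y 0) = 0 \<or> g (Y 0) = 1/2"
      using SG_half[OF g(1)] by blast+
    with g(2) show ?thesis by (elim disjE; simp only: not_True_eq_False; simp)
  qed
  then have "F g - S g = {X 0} \<or> F g - S g = {Y 0}"
    unfolding F_minus_S by auto
  then have "(\<Sum>i\<in>F g - S g. twist_involution i) = 1/2"
    by (elim disjE) (simp_all only: sum.insert, simp_all add: twist_involution_def)
  then have "quad_char g twist_involution = - 1"
    by (simp only: quad_char_def e2pi_half)
  moreover have "form_action (S g) twist_involution p = form_action (S g) (\<lambda>_. 0) p"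
    by (rule form_action_cong_Ints) (auto simp: twist_involution_def fixed_vars_def)
  moreover have "form_action (S g) (\<lambda>_. 0) p = p"
    by (rule poly_mapping_eqI) (simp add: coeff_form_action)
  moreover have "Const (quad_char g twist_involution) * form_action (S g) twist_involution p - p \<in> J' g"
    using C twist_in_SG p by (simp add: sector_iff)
  ultimately have "- p - p \<in> J' g" by simp
  from jacobian_ideal_uminus[OF this] have "p + p \<in> J' g" by (simp only: minus_diff_eq diff_minus_eq_add)
  then have "p \<in> J g" by (rule J'_subset_J[OF half_in_J'])
  then show ?thesis by (simp add: p(2) jacobian_class_eq_zero_iff)
qed

section \<open>The isomorphism of state spaces\<close>

abbreviation "V \<equiv> state_space I W SG"
abbreviation "V' \<equiv> state_space I_tw W_tw G_tw"

text \<open>Classes are sets of polynomials, so restricting variables is taking an image. Mixed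
  sectors do not occur in the formula; their invariants vanish by
  \<open>sector_mixed\<close>.\<close>

definition tw_map :: "((var \<Rightarrow> rat) \<Rightarrow> var mpoly set) \<Rightarrow> (var \<Rightarrow> rat) \<Rightarrow> var mpoly set" where
  "tw_map s = (\<lambda>k\<in>G_tw. restrict_poly (S k) ` s k
    \<oplus>\<^bsub>jacobian_ring I_tw W_tw k\<^esub> restrict_poly (S k) ` s (twisted k))"

text \<open>Replaces images of sets by representatives free of \<open>X 0\<close> and
  \<open>Y 0\<close>; every later computation with \<open>tw_map\<close> goes through it.\<close>

lemma tw_map_apply:
  assumes "k \<in> G_tw" "p \<in> carrier (poly_ring (S k))" "q \<in> carrier (poly_ring (S k))"
    and "s k = cls k p" "s (twisted k) = cls (twisted k) q"
  shows "tw_map s k = cls' k (p + q)"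
  using assms restrict_cls[of k p] restrict_cls[of "twisted k" q]
  by (simp add: tw_map_def restrict_poly_ident jacobian_ring_add)

lemma tw_map_extensional: "tw_map s \<in> extensional G_tw"
  by (simp add: tw_map_def)

text \<open>Both components at once, with representatives in the same polynomial ring. The opposite
  signs in the two conditions on \<open>w1\<close> come from \<open>dx0\<close> and
  \<open>dy0\<close> being part of the form only in the sector of \<open>k\<close>.\<close>

lemma state_space_reps:
  assumes s: "s \<in> carrier V" and k: "k \<in> G_tw"
  obtains p q where "p \<in> carrier (poly_ring (S k))" "q \<in> carrier (poly_ring (S k))"
    "s k = cls k p" "s (twisted k) = cls (twisted k) q"
    "\<forall>h\<in>G_tw. form_action (S k) h p - p \<in> J' k"
    "\<forall>h\<in>G_tw. form_action (S k) h q - q \<in> J' k"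
    "form_action (S k) w1 p + p \<in> J' k" "form_action (S k) w1 q - q \<in> J' k"
proof -
  have sk: "s k \<in> invariant_sector I W SG k" "s (twisted k) \<in> invariant_sector I W SG (twisted k)"
    using state_space_carrierD(2)[OF s] G_tw_SG[OF k] twisted_in_SG[OF k] by auto
  obtain p where p: "p \<in> carrier (poly_ring (S k))" "s k = cls k p"
    using sk(1) by (rule sectorE)
  obtain q where "q \<in> carrier (poly_ring (S (twisted k)))" and q': "s (twisted k) = cls (twisted k) q"
    using sk(2) by (rule sectorE)
  then have q: "q \<in> carrier (poly_ring (S k))" by simp
  have "form_action (S k) w1 p + p = - (Const (- 1) * form_action (S k) w1 p - p)"
    by simp
  also have "\<dots> \<in> J' k"
    by (rule jacobian_ideal_uminus) (use sk(1) p k in \<open>simp add: sector_G_tw_iff\<close>)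
  finally have "form_action (S k) w1 p + p \<in> J' k" .
  then show ?thesis
    using that[OF p(1) q p(2) q'] sk p q q' k by (simp add: sector_G_tw_iff sector_twisted_iff)
qed

lemma SG_symmetries [simp]: "\<And>h a. h \<in> SG \<Longrightarrow> a \<in> keys W \<Longrightarrow> pairing a h \<in> \<int>"
  and G_tw_symmetries [simp]: "\<And>h a. h \<in> G_tw \<Longrightarrow> a \<in> keys W_tw \<Longrightarrow> pairing a h \<in> \<int>"
  using SG_pairing SG_pairing_tw G_tw_SG by auto

lemma tw_map_closed:
  assumes s: "s \<in> carrier V"
  shows "tw_map s \<in> carrier V'"
  unfolding state_space_carrier_iff PiE_iff
proof (intro conjI ballI tw_map_extensional)
  fix k assume k: "k \<in> G_tw"
  obtain p q where pq: "p \<in> carrier (poly_ring (S k))" "q \<in> carrier (poly_ring (S k))"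
    "s k = cls k p" "s (twisted k) = cls (twisted k) q"
    and ip: "\<forall>h\<in>G_tw. form_action (S k) h p - p \<in> J' k"
    and iq: "\<forall>h\<in>G_tw. form_action (S k) h q - q \<in> J' k"
    using state_space_reps[OF s k] by metis
  have "form_action (S k) h (p + q) - (p + q) \<in> J' k" if "h \<in> G_tw" for h
    using jacobian_ideal_add[OF ip[rule_format, OF that] iq[rule_format, OF that]] by (simp add: form_action_add algebra_simps)
  then show "tw_map s k \<in> invariant_sector I_tw W_tw G_tw k"
    using pq by (simp add: tw_map_apply[OF k pq] tw_sector_iff poly_ring_add)
next
  let ?A = "{g \<in> SG. s g \<noteq> \<zero>\<^bsub>jacobian_ring I W g\<^esub>}"
  have fin: "finite ?A" by (rule state_space_carrierD(4)[OF s])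
  \<comment> \<open>A nonzero component of the image at \<open>k\<close> needs a nonzero component
    of \<open>s\<close> at \<open>k\<close> or at \<open>twisted k\<close>; injectivity keeps the
    second set of indices finite.\<close>
  have "inj_on twisted G_tw" using untwisted_twisted by (metis inj_onI)
  then have "finite (twisted -` ?A \<inter> G_tw)" using fin by (intro finite_vimage_IntI)
  moreover have "{k \<in> G_tw. tw_map s k \<noteq> \<zero>\<^bsub>jacobian_ring I_tw W_tw k\<^esub>} \<subseteq> ?A \<union> (twisted -` ?A \<inter> G_tw)"
  proof
    fix k assume "k \<in> {k \<in> G_tw. tw_map s k \<noteq> \<zero>\<^bsub>jacobian_ring I_tw W_tw k\<^esub>}"
    then have k: "k \<in> G_tw" and nz: "tw_map s k \<noteq> \<zero>\<^bsub>jacobian_ring I_tw W_tw k\<^esub>" by auto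
    have "s k \<noteq> \<zero>\<^bsub>jacobian_ring I W k\<^esub> \<or> s (twisted k) \<noteq> \<zero>\<^bsub>jacobian_ring I W (twisted k)\<^esub>"
      using nz tw_map_apply[OF k, of 0 0 s] by (auto simp: jacobian_ring_zero)
    then show "k \<in> ?A \<union> (twisted -` ?A \<inter> G_tw)"
      using k G_tw_SG twisted_in_SG by blast
  qed
  ultimately show "finite {k \<in> G_tw. tw_map s k \<noteq> \<zero>\<^bsub>jacobian_ring I_tw W_tw k\<^esub>}"
    using fin finite_subset by blast
qed

lemma tw_map_add:
  assumes s: "s \<in> carrier V" and t: "t \<in> carrier V"
  shows "tw_map (s \<oplus>\<^bsub>V\<^esub> t) = tw_map s \<oplus>\<^bsub>V'\<^esub> tw_map t"
proof (rule state_space_eqI[OF tw_map_extensional state_space_extensional(2)])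
  fix k assume k: "k \<in> G_tw"
  obtain p q where pq: "p \<in> carrier (poly_ring (S k))" "q \<in> carrier (poly_ring (S k))"
    "s k = cls k p" "s (twisted k) = cls (twisted k) q"
    using state_space_reps[OF s k] by metis
  obtain p' q' where pq': "p' \<in> carrier (poly_ring (S k))" "q' \<in> carrier (poly_ring (S k))"
    "t k = cls k p'" "t (twisted k) = cls (twisted k) q'"
    using state_space_reps[OF t k] by metis
  have SF: "r \<in> carrier (poly_ring (F g))" if "r \<in> carrier (poly_ring (S g))" for r g
    by (rule poly_ring_mono[OF S_subset(1) that])
  have "(s \<oplus>\<^bsub>V\<^esub> t) k = cls k (p + p')"
    using pq pq' SF by (simp add: state_space_add_apply G_tw_SG[OF k] jacobian_ring_add)
  moreover have "(s \<oplus>\<^bsub>V\<^esub> t) (twisted k) = cls (twisted k) (q + q')"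
    using pq pq' SF[of _ "twisted k"] by (simp add: state_space_add_apply twisted_in_SG[OF k] jacobian_ring_add)
  ultimately have "tw_map (s \<oplus>\<^bsub>V\<^esub> t) k = cls' k ((p + p') + (q + q'))"
    using pq pq' by (intro tw_map_apply k) auto
  also have "\<dots> = cls' k ((p + q) + (p' + q'))" by (simp add: ac_simps)
  also have "\<dots> = (tw_map s \<oplus>\<^bsub>V'\<^esub> tw_map t) k"
    using pq pq' by (simp add: state_space_add_apply k tw_map_apply[OF k pq] tw_map_apply[OF k pq']
        jacobian_ring_add poly_ring_add)
  finally show "tw_map (s \<oplus>\<^bsub>V\<^esub> t) k = (tw_map s \<oplus>\<^bsub>V'\<^esub> tw_map t) k" .
qed

lemma tw_map_smult:
  assumes s: "s \<in> carrier V"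
  shows "tw_map (c \<odot>\<^bsub>V\<^esub> s) = c \<odot>\<^bsub>V'\<^esub> tw_map s"
proof (rule state_space_eqI[OF tw_map_extensional state_space_extensional(3)])
  fix k assume k: "k \<in> G_tw"
  obtain p q where pq: "p \<in> carrier (poly_ring (S k))" "q \<in> carrier (poly_ring (S k))"
    "s k = cls k p" "s (twisted k) = cls (twisted k) q"
    using state_space_reps[OF s k] by metis
  have SF: "r \<in> carrier (poly_ring (F g))" if "r \<in> carrier (poly_ring (S g))" for r g
    by (rule poly_ring_mono[OF S_subset(1) that])
  have "(c \<odot>\<^bsub>V\<^esub> s) k = cls k (Const c * p)"
    using pq SF by (simp add: state_space_smult_apply G_tw_SG[OF k] jacobian_ring_smult)
  moreover have "(c \<odot>\<^bsub>V\<^esub> s) (twisted k) = cls (twisted k) (Const c * q)"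
    using pq SF[of _ "twisted k"] by (simp add: state_space_smult_apply twisted_in_SG[OF k] jacobian_ring_smult)
  ultimately have "tw_map (c \<odot>\<^bsub>V\<^esub> s) k = cls' k (Const c * p + Const c * q)"
    using pq by (intro tw_map_apply k) auto
  also have "\<dots> = (c \<odot>\<^bsub>V'\<^esub> tw_map s) k"
    using pq by (simp add: state_space_smult_apply k tw_map_apply[OF k pq] jacobian_ring_smult
        poly_ring_add distrib_left)
  finally show "tw_map (c \<odot>\<^bsub>V\<^esub> s) k = (c \<odot>\<^bsub>V'\<^esub> tw_map s) k" .
qed

text \<open>Injectivity: \<open>w1\<close> acts by \<open>-1\<close> on the contribution of the sector of \<open>k\<close> and by \<open>1\<close> on that of
  \<open>twisted k\<close>.\<close>

lemma tw_map_inj: "inj_on tw_map (carrier V)"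
proof (rule inj_onI)
  fix s t assume s: "s \<in> carrier V" and t: "t \<in> carrier V" and eq: "tw_map s = tw_map t"
  have both: "s k = t k \<and> s (twisted k) = t (twisted k)" if k: "k \<in> G_tw" for k
  proof -
    obtain p q where pq: "p \<in> carrier (poly_ring (S k))" "q \<in> carrier (poly_ring (S k))"
      "s k = cls k p" "s (twisted k) = cls (twisted k) q"
      and w: "form_action (S k) w1 p + p \<in> J' k" "form_action (S k) w1 q - q \<in> J' k"
      using state_space_reps[OF s k] by metis
    obtain p' q' where pq': "p' \<in> carrier (poly_ring (S k))" "q' \<in> carrier (poly_ring (S k))"
      "t k = cls k p'" "t (twisted k) = cls (twisted k) q'"
      and w': "form_action (S k) w1 p' + p' \<in> J' k" "form_action (S k) w1 q' - q' \<in> J' k"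
      using state_space_reps[OF t k] by metis
    define d e where "d = p - p'" and "e = q - q'"
    have d: "form_action (S k) w1 d + d \<in> J' k"
      using jacobian_ideal_diff[OF w(1) w'(1)] by (simp add: d_def form_action_diff algebra_simps)
    have e: "form_action (S k) w1 e - e \<in> J' k"
      using jacobian_ideal_diff[OF w(2) w'(2)] by (simp add: e_def form_action_diff algebra_simps)
    have "cls' k (p + q) = cls' k (p' + q')"
      using eq by (simp flip: tw_map_apply[OF k pq] tw_map_apply[OF k pq'])
    then have de: "d + e \<in> J' k"
      by (simp add: jacobian_class_eq_iff d_def e_def algebra_simps)
    have fde: "form_action (S k) w1 d + form_action (S k) w1 e \<in> J' k"
      using form_action_J'[OF w1_in_SG de] by (simp add: form_action_add)
    \<comment> \<open>The sum collapses to \<open>d + d\<close>: subtracting from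
      \<open>d + e\<close> its transform under \<open>w1\<close> doubles the -1 part and kills the
      other.\<close>
    have "(d + e) - (form_action (S k) w1 d + form_action (S k) w1 e)
        + (form_action (S k) w1 d + d) + (form_action (S k) w1 e - e) \<in> J' k"
      by (intro jacobian_ideal_add jacobian_ideal_diff de fde d e)
    then have "d \<in> J' k" by (rule half_in_J'[OF back_subst[of "\<lambda>x. x \<in> J' k"]]) (simp add: algebra_simps)
    moreover from jacobian_ideal_diff[OF de this] have "e \<in> J' k" by simp
    ultimately have "p - p' \<in> J k" "q - q' \<in> J (twisted k)"
      using J'_subset_J[of d k] J'_subset_J[of e "twisted k"] by (simp_all add: d_def e_def)
    then show ?thesis using pq pq' by (simp add: jacobian_class_eq_iff)
  qed
  show "s = t"
  proof (rule state_space_eqI[OF state_space_carrierD(1)[OF s] state_space_carrierD(1)[OF t]])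
    fix g assume g: "g \<in> SG"
    then show "s g = t g"
    proof (cases rule: SG_cases)
      case fixed then show ?thesis using both by blast
    next
      case moved then show ?thesis using both[of "untwisted g"] by simp
    next
      case mixed then show ?thesis
        using sector_mixed[OF g mixed state_space_carrierD(2)[OF s g]]
          sector_mixed[OF g mixed state_space_carrierD(2)[OF t g]] by simp
    qed
  qed
qed

text \<open>The component at \<open>k\<close> is split into its eigenparts \<open>(r - fr)/2\<close>
  and \<open>(r + fr)/2\<close> under \<open>w1\<close>; the former is placed in the sector of
  \<open>k\<close>, the latter in that of \<open>twisted k\<close>.\<close>

lemma tw_map_surj:
  assumes t: "t \<in> carrier V'"
  shows "\<exists>s\<in>carrier V. tw_map s = t"
proof -
  have "\<exists>r. r \<in> carrier (poly_ring (S k)) \<and> t k = cls' k r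
      \<and> (\<forall>h\<in>G_tw. form_action (S k) h r - r \<in> J' k)" if k: "k \<in> G_tw" for k
  proof -
    have "t k \<in> invariant_sector I_tw W_tw G_tw k"
      using state_space_carrierD(2)[OF t k] .
    moreover from this obtain r where "r \<in> carrier (poly_ring (S k))" "t k = cls' k r"
      by (rule invariant_sectorE)
    ultimately show ?thesis by (auto simp: tw_sector_iff)
  qed
  then obtain r where r: "\<And>k. k \<in> G_tw \<Longrightarrow> r k \<in> carrier (poly_ring (S k))"
    and tr: "\<And>k. k \<in> G_tw \<Longrightarrow> t k = cls' k (r k)"
    and rinv: "\<And>k h. k \<in> G_tw \<Longrightarrow> h \<in> G_tw \<Longrightarrow> form_action (S k) h (r k) - r k \<in> J' k"
    by metis
  define fr where "fr k = form_action (S k) w1 (r k)" for k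
  define rm rp where "rm k = Const (1/2) * (r k - fr k)" and "rp k = Const (1/2) * (r k + fr k)" for k
  have frc: "fr k \<in> carrier (poly_ring (S k))" if "k \<in> G_tw" for k
    using r[OF that] by (auto simp: fr_def)
  have rmc: "rm k \<in> carrier (poly_ring (S k))" "rp k \<in> carrier (poly_ring (S k))" if "k \<in> G_tw" for k
    using r[OF that] frc[OF that] by (auto simp: rm_def rp_def)
  have sum: "rm k + rp k = r k" for k
    by (rule poly_mapping_eqI) (simp only: rm_def rp_def lookup_add lookup_minus coeff_Const_mult, simp add: field_simps)
  \<comment> \<open>Diagonal actions commute, so \<open>w1\<close> preserves invariance under
    \<open>G_tw\<close>.\<close>
  have frinv: "form_action (S k) h (fr k) - fr k \<in> J' k" if "k \<in> G_tw" "h \<in> G_tw" for k h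
  proof -
    have "form_action (S k) h (fr k) - fr k = form_action (S k) w1 (form_action (S k) h (r k) - r k)"
      by (simp add: fr_def form_action_diff form_action_compose add.commute)
    with form_action_J'[OF w1_in_SG rinv[OF that]] show ?thesis by simp
  qed
  have sq: "form_action (S k) w1 (fr k) - r k \<in> J' k" if k: "k \<in> G_tw" for k
  proof -
    \<comment> \<open>At \<open>X 0\<close> the two halves add up to an integer, so the square of
      \<open>w1\<close> is in \<open>G_tw\<close> and fixes the class of \<open>r k\<close>.\<close>
    let ?w = "\<lambda>i. frac (w1 i + w1 i)"
    have "?w \<in> G_tw"
      using SG_mult[OF w1_in_SG w1_in_SG] by (simp add: G_tw_iff)
    moreover have "form_action (S k) w1 (fr k) = form_action (S k) ?w (r k)"
      unfolding fr_def form_action_compose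
      by (rule form_action_cong_Ints) (simp add: frac_def)
    ultimately show ?thesis using rinv[OF k] by simp
  qed
  have inv: "form_action (S k) h (rm k) - rm k \<in> J' k" "form_action (S k) h (rp k) - rp k \<in> J' k"
    if k: "k \<in> G_tw" and h: "h \<in> G_tw" for k h
  proof -
    have "form_action (S k) h (rm k) - rm k
        = Const (1/2) * ((form_action (S k) h (r k) - r k) - (form_action (S k) h (fr k) - fr k))"
      by (simp add: rm_def form_action_Const_mult form_action_diff right_diff_distrib)
    also have "\<dots> \<in> J' k"
      by (intro jacobian_ideal_Const_mult jacobian_ideal_diff rinv frinv k h)
    finally show "form_action (S k) h (rm k) - rm k \<in> J' k" .
    have "form_action (S k) h (rp k) - rp k
        = Const (1/2) * ((form_action (S k) h (r k) - r k) + (form_action (S k) h (fr k) - fr k))"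
      by (simp add: rp_def form_action_Const_mult form_action_add right_diff_distrib distrib_left)
    also have "\<dots> \<in> J' k"
      by (intro jacobian_ideal_Const_mult jacobian_ideal_add rinv frinv k h)
    finally show "form_action (S k) h (rp k) - rp k \<in> J' k" .
  qed
  have eig: "Const (- 1) * form_action (S k) w1 (rm k) - rm k \<in> J' k"
    "Const 1 * form_action (S k) w1 (rp k) - rp k \<in> J' k" if k: "k \<in> G_tw" for k
  proof -
    have "Const (- 1) * form_action (S k) w1 (rm k) - rm k
        = Const (1/2) * (form_action (S k) w1 (fr k) - r k)"
      by (simp add: rm_def form_action_Const_mult form_action_diff right_diff_distrib fr_def)
    also have "\<dots> \<in> J' k" by (intro jacobian_ideal_Const_mult sq k)
    finally show "Const (- 1) * form_action (S k) w1 (rm k) - rm k \<in> J' k" .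
    have "Const 1 * form_action (S k) w1 (rp k) - rp k
        = Const (1/2) * (form_action (S k) w1 (fr k) - r k)"
      by (simp add: rp_def form_action_Const_mult form_action_add right_diff_distrib distrib_left fr_def)
    also have "\<dots> \<in> J' k" by (intro jacobian_ideal_Const_mult sq k)
    finally show "Const 1 * form_action (S k) w1 (rp k) - rp k \<in> J' k" .
  qed
  \<comment> \<open>Outside \<open>G_tw\<close>, equal entries at \<open>X 0\<close> and
    \<open>Y 0\<close> mean that both are 1/2, so the second case consists of the elements
    \<open>twisted k\<close>. Mixed sectors have no nonzero invariants and get 0.\<close>
  define s where "s = (\<lambda>g\<in>SG. if g \<in> G_tw then cls g (rm g)
      else if g (X 0) = g (Y 0) then cls g (rp (untwisted g)) else \<zero>\<^bsub>jacobian_ring I W g\<^esub>)"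
  have s_fixed: "s k = cls k (rm k)" and s_moved: "s (twisted k) = cls (twisted k) (rp k)" if k: "k \<in> G_tw" for k
  proof -
    have "twisted k \<notin> G_tw" by (simp add: G_tw_iff)
    then show "s k = cls k (rm k)" "s (twisted k) = cls (twisted k) (rp k)"
      using k G_tw_SG twisted_in_SG untwisted_twisted by (simp_all add: s_def)
  qed
  have s_mixed: "s g = \<zero>\<^bsub>jacobian_ring I W g\<^esub>" if "g \<in> SG" "g (X 0) \<noteq> g (Y 0)" for g
    using that by (auto simp: s_def G_tw_iff)
  have "s \<in> carrier V"
    unfolding state_space_carrier_iff PiE_iff
  proof (intro conjI ballI)
    fix g assume g: "g \<in> SG"
    then show "s g \<in> invariant_sector I W SG g"
    proof (cases rule: SG_cases)
      case fixed
      then show ?thesis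
        using inv(1)[OF fixed] eig(1)[OF fixed] rmc[OF fixed] by (simp add: s_fixed sector_G_tw_iff)
    next
      case moved
      let ?k = "untwisted g"
      have "s (twisted ?k) \<in> invariant_sector I W SG (twisted ?k)"
        using inv(2)[OF moved(3)] eig(2)[OF moved(3)] rmc[OF moved(3)] moved(3)
        by (simp add: s_moved sector_twisted_iff)
      then show ?thesis using moved(4) by simp
    next
      case mixed
      then show ?thesis using g by (simp add: s_mixed invariant_sector_zero)
    qed
  next
    let ?A = "{k \<in> G_tw. t k \<noteq> \<zero>\<^bsub>jacobian_ring I_tw W_tw k\<^esub>}"
    have fin: "finite ?A" by (rule state_space_carrierD(4)[OF t])
    \<comment> \<open>Finite support of \<open>s\<close>: since \<open>w1\<close> preserves the
      ideal, both eigenparts vanish wherever \<open>t\<close> does.\<close>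
    have small: "rm k \<in> J' k \<and> rp k \<in> J' k" if k: "k \<in> G_tw" "k \<notin> ?A" for k
    proof -
      have rk: "r k \<in> J' k" using k tr[of k] by (simp add: jacobian_class_eq_zero_iff)
      then have "fr k \<in> J' k" unfolding fr_def by (rule form_action_J'[OF w1_in_SG])
      with rk show ?thesis
        unfolding rm_def rp_def
        by (intro conjI jacobian_ideal_Const_mult jacobian_ideal_diff jacobian_ideal_add)
    qed
    have "{g \<in> SG. s g \<noteq> \<zero>\<^bsub>jacobian_ring I W g\<^esub>} \<subseteq> ?A \<union> twisted ` ?A"
    proof
      fix g assume "g \<in> {g \<in> SG. s g \<noteq> \<zero>\<^bsub>jacobian_ring I W g\<^esub>}"
      then have g: "g \<in> SG" and nz: "s g \<noteq> \<zero>\<^bsub>jacobian_ring I W g\<^esub>" by auto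
      from g show "g \<in> ?A \<union> twisted ` ?A"
      proof (cases rule: SG_cases)
        case fixed
        with nz have "rm g \<notin> J' g"
          using J'_subset_J by (auto simp: s_fixed jacobian_class_eq_zero_iff)
        with small[OF fixed] show ?thesis by blast
      next
        case moved
        let ?k = "untwisted g"
        have "s (twisted ?k) \<noteq> \<zero>\<^bsub>jacobian_ring I W (twisted ?k)\<^esub>" using nz moved(4) by simp
        then have "rp ?k \<notin> J' ?k"
          using J'_subset_J[of "rp ?k" "twisted ?k"] moved(3)
          by (auto simp: s_moved jacobian_class_eq_zero_iff)
        with small[OF moved(3)] have "?k \<in> ?A" by blast
        then have "twisted ?k \<in> twisted ` ?A" by (rule imageI)
        with moved(4) show ?thesis by simp
      next
        case mixed
        with nz g show ?thesis by (simp add: s_mixed)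
      qed
    qed
    then show "finite {g \<in> SG. s g \<noteq> \<zero>\<^bsub>jacobian_ring I W g\<^esub>}"
      using fin finite_subset by blast
  qed (simp add: s_def)
  moreover have "tw_map s = t"
  proof (rule state_space_eqI[OF tw_map_extensional state_space_carrierD(1)[OF t]])
    fix k assume k: "k \<in> G_tw"
    show "tw_map s k = t k"
      by (simp add: tw_map_apply[OF k rmc[OF k] s_fixed[OF k] s_moved[OF k]] sum tr[OF k])
  qed
  ultimately show ?thesis by blast
qed

lemma tw_map_iso: "tw_map \<in> module_iso complex_ring V V'"
proof -
  have "tw_map ` carrier V = carrier V'"
    using tw_map_closed tw_map_surj by (metis (no_types, lifting) image_eqI image_subsetI subsetI subset_antisym)
  then have "bij_betw tw_map (carrier V) (carrier V')"
    using tw_map_inj by (simp only: bij_betw_def)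
  then show ?thesis
    unfolding module_iso_def using tw_map_add tw_map_smult by blast
qed

section \<open>Generators and their bi-degrees\<close>

lemma twisted_neq: "k \<in> G_tw \<Longrightarrow> twisted k' \<noteq> k" "k \<in> G_tw \<Longrightarrow> k \<noteq> twisted k'"
  by (auto simp: G_tw_iff)

lemma twisted_eq_iff: "k \<in> G_tw \<Longrightarrow> k' \<in> G_tw \<Longrightarrow> twisted k = twisted k' \<longleftrightarrow> k = k'"
  using untwisted_twisted by metis

lemma tw_map_zero: "tw_map \<zero>\<^bsub>V\<^esub> = \<zero>\<^bsub>V'\<^esub>"
proof (rule state_space_eqI[OF tw_map_extensional state_space_extensional(1)])
  fix k assume k: "k \<in> G_tw"
  have "tw_map \<zero>\<^bsub>V\<^esub> k = cls' k (0 + 0)"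
    by (rule tw_map_apply[OF k])
      (simp_all add: state_space_zero_apply G_tw_SG[OF k] twisted_in_SG[OF k] jacobian_ring_zero)
  then show "tw_map \<zero>\<^bsub>V\<^esub> k = \<zero>\<^bsub>V'\<^esub> k"
    by (simp add: state_space_zero_apply k jacobian_ring_zero)
qed

lemma tw_map_sector_fixed:
  assumes k: "k \<in> G_tw" and a: "keys a \<subseteq> S k"
  shows "tw_map (sector_element I W SG a k) = sector_element I_tw W_tw G_tw a k"
proof (rule state_space_eqI[OF tw_map_extensional sector_element_extensional])
  fix k' assume k': "k' \<in> G_tw"
  have "tw_map (sector_element I W SG a k) k' = cls' k' ((if k' = k then monomial a else 0) + 0)"
    by (rule tw_map_apply[OF k'])
      (use k a in \<open>simp_all add: sector_element_def G_tw_SG[OF k'] twisted_in_SG[OF k'] jacobian_ring_zero twisted_neq\<close>)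
  with k' show "tw_map (sector_element I W SG a k) k' = sector_element I_tw W_tw G_tw a k k'"
    by (simp add: sector_element_def jacobian_ring_zero)
qed

lemma tw_map_sector_moved:
  assumes k: "k \<in> G_tw" and a: "keys a \<subseteq> S k"
  shows "tw_map (sector_element I W SG a (twisted k)) = sector_element I_tw W_tw G_tw a k"
proof (rule state_space_eqI[OF tw_map_extensional sector_element_extensional])
  fix k' assume k': "k' \<in> G_tw"
  have "tw_map (sector_element I W SG a (twisted k)) k' = cls' k' (0 + (if k' = k then monomial a else 0))"
    by (rule tw_map_apply[OF k'])
      (use k k' a in \<open>simp_all add: sector_element_def G_tw_SG[OF k'] twisted_in_SG[OF k'] jacobian_ring_zero
        twisted_neq twisted_eq_iff\<close>)
  with k' show "tw_map (sector_element I W SG a (twisted k)) k' = sector_element I_tw W_tw G_tw a k k'"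
    by (simp add: sector_element_def jacobian_ring_zero)
qed

lemma form_deg_tw: "form_deg I_tw W_tw a k = (\<Sum>i\<in>S k. (of_nat (coeff a i) + 1) * w i)"
  unfolding form_deg_def weights_W_tw by (rule sum.cong) (auto simp: fixed_vars_def)

lemma fixed_dim_tw: "k \<in> G_tw \<Longrightarrow> fixed_dim I_tw k = card (S k)"
  by (rule fixed_dim_eq_card) (auto simp: G_tw twist_group_def Gmax_def)

lemma S_0 [simp]: "X 0 \<notin> S g" "Y 0 \<notin> S g" "finite (S g)"
  using S_subset(2)[of g] by (auto simp: fixed_vars_def)

text \<open>The fixed variables \<open>X 0\<close> and \<open>Y 0\<close> add 1/2 each to the degree
  of the form and 2 to the dimension. In both entries this amounts to 1, the amount by which the age
  of the grading operator of \<open>W\<close> exceeds that of \<open>W_tw\<close>.\<close>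

lemma bidegree_fixed:
  assumes k: "k \<in> G_tw" and a: "keys a \<subseteq> S k"
  shows "bidegree I W a k = bidegree I_tw W_tw a k"
proof -
  have F: "F k = insert (X 0) (insert (Y 0) (S k))"
    using k by (auto simp: fixed_vars_def I_eq G_tw_iff)
  have a0: "coeff a (X 0) = 0" "coeff a (Y 0) = 0"
    using a S_0 by (metis in_keys_iff subsetD)+
  have "form_deg I W a k = form_deg I_tw W_tw a k + 1"
    by (simp add: form_deg_tw) (simp add: form_deg_def weights_W F a0)
  moreover have "age I k = age I_tw k"
    using k by (simp add: age_def I_eq G_tw_iff)
  moreover have "fixed_dim I k = fixed_dim I_tw k + 2"
    using fixed_dim_eq_card[OF finite_I(1) SG_carrier[OF G_tw_SG[OF k]]]
    by (simp add: F fixed_dim_tw[OF k])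
  ultimately show ?thesis
    by (simp add: bidegree_def age_grading_op)
qed

text \<open>Degree and dimension are unchanged here; the two entries 1/2 raise the age by 1 and
  offset the larger age of the grading operator.\<close>

lemma bidegree_moved:
  assumes k: "k \<in> G_tw"
  shows "bidegree I W a (twisted k) = bidegree I_tw W_tw a k"
proof -
  have F: "F (twisted k) = S k"
    by (auto simp: fixed_vars_def I_eq twisted_def)
  have "form_deg I W a (twisted k) = form_deg I_tw W_tw a k"
    by (simp add: form_deg_tw) (simp add: form_deg_def weights_W F)
  moreover have "age I (twisted k) = age I_tw k + 1"
  proof -
    have "sum (twisted k) I_tw = sum k I_tw"
      by (rule sum.cong) (auto simp: twisted_def)
    then show ?thesis by (simp add: age_def I_eq)
  qed
  moreover have "fixed_dim I (twisted k) = fixed_dim I_tw k"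
    using fixed_dim_eq_card[OF finite_I(1) SG_carrier[OF twisted_in_SG[OF k]]]
    by (simp add: F fixed_dim_tw[OF k])
  ultimately show ?thesis
    by (simp add: bidegree_def age_grading_op)
qed

text \<open>The value 0 arises in two ways: the monomial contains a fixed quadratic variable and
  lies in the ideal, or the sector is mixed. Otherwise the generator belongs to some
  \<open>k\<close> or \<open>twisted k\<close>.\<close>

lemma tw_map_generator:
  assumes g: "g \<in> SG" and a: "keys a \<subseteq> F g" and s: "sector_element I W SG a g \<in> carrier V"
  shows "tw_map (sector_element I W SG a g) = \<zero>\<^bsub>V'\<^esub> \<or>
    (\<exists>k\<in>G_tw. keys a \<subseteq> S k \<and> tw_map (sector_element I W SG a g) = sector_element I_tw W_tw G_tw a k
      \<and> bidegree I W a g = bidegree I_tw W_tw a k)"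
proof (cases "keys a \<subseteq> S g")
  case False
  then have "restrict_poly (S g) (monomial a) = 0"
    by (intro poly_mapping_eqI) (auto simp: coeff_restrict_poly monomial_def lookup_single when_def)
  then have "monomial a \<in> J g" using diff_restrict_in_J[of "monomial a" g] a by simp
  then show ?thesis by (simp add: sector_element_eq_zero tw_map_zero)
next
  case True
  from g show ?thesis
  proof (cases rule: SG_cases)
    case fixed
    with True show ?thesis using tw_map_sector_fixed bidegree_fixed by blast
  next
    case moved
    let ?k = "untwisted g"
    have "keys a \<subseteq> S ?k" using True moved(4) S_twisted[of ?k] by simp
    then show ?thesis
      using tw_map_sector_moved[OF moved(3), of a] bidegree_moved[OF moved(3), of a] moved(3,4) by auto
  next
    case mixed
    have "cls g (monomial a) = \<zero>\<^bsub>jacobian_ring I W g\<^esub>"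
      using s sector_mixed[OF g mixed] sector_element_in_state_space_iff[OF finite_I(1) SG_pairing g]
      by blast
    then show ?thesis
      by (simp add: jacobian_class_eq_zero_iff sector_element_eq_zero tw_map_zero)
  qed
qed

text \<open>The square of \<open>w1\<close> lies in \<open>G_tw\<close>, so \<open>w1\<close> acts on an invariant monomial by a sign; this
  sign decides which of the sectors of \<open>k\<close> and \<open>twisted k\<close> contains its preimage.\<close>

lemma tw_generator_preimage:
  assumes k: "k \<in> G_tw" and a: "keys a \<subseteq> S k" and t: "sector_element I_tw W_tw G_tw a k \<in> carrier V'"
  shows "sector_element I_tw W_tw G_tw a k = \<zero>\<^bsub>V'\<^esub> \<or>
    (\<exists>g\<in>SG. keys a \<subseteq> F g \<and> sector_element I W SG a g \<in> carrier V
      \<and> tw_map (sector_element I W SG a g) = sector_element I_tw W_tw G_tw a k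
      \<and> bidegree I W a g = bidegree I_tw W_tw a k)"
proof (cases "monomial a \<in> J' k")
  case True
  then show ?thesis by (simp add: sector_element_eq_zero)
next
  case False
  let ?m = "monomial a"
  have m: "?m \<in> carrier (poly_ring (S k))" using a by simp
  have "cls' k ?m \<in> invariant_sector I_tw W_tw G_tw k"
    using t sector_element_in_state_space_iff[of I_tw G_tw W_tw k a] k by simp
  then have inv: "\<forall>h\<in>G_tw. form_action (S k) h ?m - ?m \<in> J' k"
    using m by (simp add: tw_sector_iff)
  define c where "c = e2pi (\<Sum>i\<in>S k. (of_nat (coeff a i) + 1) * w1 i)"
  have cm: "form_action (S k) w1 ?m = Const c * ?m"
    by (simp add: form_action_monomial c_def)
  let ?w = "\<lambda>i. frac (w1 i + w1 i)"
  have "?w \<in> G_tw"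
    using SG_mult[OF w1_in_SG w1_in_SG] by (simp add: G_tw_iff)
  moreover have "form_action (S k) ?w ?m = form_action (S k) w1 (form_action (S k) w1 ?m)"
    unfolding form_action_compose by (rule form_action_cong_Ints) simp
  ultimately have *: "Const c * (Const c * ?m) - ?m \<in> J' k"
    using inv by (metis cm form_action_Const_mult)
  have "c * c = 1"
  proof (rule ccontr)
    assume c: "c * c \<noteq> 1"
    \<comment> \<open>The square of \<open>w1\<close> multiplies the monomial by
      \<open>c * c\<close>, so a value other than 1 would put the monomial itself into the
      ideal.\<close>
    have "Const (1 / (c * c - 1)) * (Const c * (Const c * ?m) - ?m) = ?m"
      by (rule poly_mapping_eqI) (use c in \<open>simp only: coeff_Const_mult lookup_minus, simp add: field_simps\<close>)
    with jacobian_ideal_Const_mult[OF *, of "1 / (c * c - 1)"] False show False by simp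
  qed
  then have "c = 1 \<or> c = - 1" by (simp add: square_eq_1_iff)
  then show ?thesis
  proof
    assume "c = 1"
    then have "cls (twisted k) ?m \<in> invariant_sector I W SG (twisted k)"
      using m inv cm by (simp add: sector_twisted_iff)
    then have "sector_element I W SG a (twisted k) \<in> carrier V"
      using sector_element_in_state_space_iff[OF finite_I(1) SG_pairing twisted_in_SG[OF k]] by blast
    moreover have "keys a \<subseteq> F (twisted k)" using a S_subset(1)[of "twisted k"] by simp
    ultimately show ?thesis
      using tw_map_sector_moved[OF k a] bidegree_moved[OF k] twisted_in_SG[OF k] by blast
  next
    assume "c = - 1"
    then have "cls k ?m \<in> invariant_sector I W SG k"
      using m inv cm k by (simp add: sector_G_tw_iff)
    then have "sector_element I W SG a k \<in> carrier V"
      using sector_element_in_state_space_iff[OF finite_I(1) SG_pairing G_tw_SG[OF k]] by blast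
    moreover have "keys a \<subseteq> F k" using a S_subset(1)[of k] by simp
    ultimately show ?thesis
      using tw_map_sector_fixed[OF k a] bidegree_fixed[OF k a] G_tw_SG[OF k] by blast
  qed
qed

lemma tw_map_bidegree_part: "tw_map ` bidegree_part I W SG d = bidegree_part I_tw W_tw G_tw d"
  unfolding bidegree_part_def
proof (rule module_iso_image_span[OF _ _ tw_map_iso])
  let ?A = "{sector_element I W SG a g | a g. g \<in> SG \<and> keys a \<subseteq> F g \<and>
    sector_element I W SG a g \<in> carrier V \<and> bidegree I W a g = d}"
  let ?B = "{sector_element I_tw W_tw G_tw a g | a g. g \<in> G_tw \<and> keys a \<subseteq> S g \<and>
    sector_element I_tw W_tw G_tw a g \<in> carrier V' \<and> bidegree I_tw W_tw a g = d}"
  show "abelian_group V" "abelian_group V'"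
    by (rule state_space_abelian_group; simp)+
  show "c \<odot>\<^bsub>V\<^esub> x \<in> carrier V" if "x \<in> carrier V" for c x
    by (rule state_space_smult_closed[OF _ _ that]) simp_all
  show "c \<odot>\<^bsub>V'\<^esub> x \<in> carrier V'" if "x \<in> carrier V'" for c x
    by (rule state_space_smult_closed[OF _ _ that]) simp_all
  show "?A \<subseteq> carrier V" "?B \<subseteq> carrier V'" by auto
  show "tw_map ` ?A \<subseteq> insert \<zero>\<^bsub>V'\<^esub> ?B"
  proof
    fix t assume "t \<in> tw_map ` ?A"
    then obtain a g where g: "g \<in> SG" "keys a \<subseteq> F g" "sector_element I W SG a g \<in> carrier V"
      and t: "t = tw_map (sector_element I W SG a g)" and d: "bidegree I W a g = d"
      by blast
    from tw_map_generator[OF g] show "t \<in> insert \<zero>\<^bsub>V'\<^esub> ?B"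
    proof
      assume "\<exists>k\<in>G_tw. keys a \<subseteq> S k \<and> tw_map (sector_element I W SG a g) = sector_element I_tw W_tw G_tw a k
        \<and> bidegree I W a g = bidegree I_tw W_tw a k"
      then obtain k where "k \<in> G_tw" "keys a \<subseteq> S k" "t = sector_element I_tw W_tw G_tw a k"
        "bidegree I_tw W_tw a k = d"
        using t d by metis
      moreover have "t \<in> carrier V'" using tw_map_closed[OF g(3)] t by simp
      ultimately show ?thesis by blast
    qed (simp add: t)
  qed
  show "?B \<subseteq> insert \<zero>\<^bsub>V'\<^esub> (tw_map ` ?A)"
  proof
    fix t assume "t \<in> ?B"
    then obtain a k where k: "k \<in> G_tw" "keys a \<subseteq> S k" "sector_element I_tw W_tw G_tw a k \<in> carrier V'"
      and t: "t = sector_element I_tw W_tw G_tw a k" and d: "bidegree I_tw W_tw a k = d"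
      by blast
    from tw_generator_preimage[OF k] show "t \<in> insert \<zero>\<^bsub>V'\<^esub> (tw_map ` ?A)"
    proof
      assume "\<exists>g\<in>SG. keys a \<subseteq> F g \<and> sector_element I W SG a g \<in> carrier V
        \<and> tw_map (sector_element I W SG a g) = sector_element I_tw W_tw G_tw a k
        \<and> bidegree I W a g = bidegree I_tw W_tw a k"
      then obtain g where "g \<in> SG" "keys a \<subseteq> F g" "sector_element I W SG a g \<in> carrier V"
        "tw_map (sector_element I W SG a g) = t" "bidegree I W a g = d"
        using t d by blast
      then show ?thesis by blast
    qed (simp add: t)
  qed
qed

end

theorem theorem3p1:
  fixes n m :: nat and f1 f2 W1 W2 W W_tw :: "var mpoly"
    and I1 I2 I I_tw :: "var set" and G \<Sigma>G G_tw :: "(var \<Rightarrow> rat) set"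
  assumes "I1 = X ` {0..n}" and "I2 = Y ` {0..m}" and "I = I1 \<union> I2"
    and "f1 \<in> carrier (poly_ring (X ` {1..n}))"
    and "f2 \<in> carrier (poly_ring (Y ` {1..m}))"
    and "W1 = Var (X 0) ^ 2 + f1" and "W2 = Var (Y 0) ^ 2 + f2" and "W = W1 + W2"
    and "invertible_poly I1 W1" and "invertible_poly I2 W2"
    and "calabi_yau I1 W1" and "calabi_yau I2 W2"
    and "subgroup G (QZ I)"
    and "Jgroup I1 W1 <#>\<^bsub>QZ I\<^esub> Jgroup I2 W2 \<subseteq> G"
    and "G \<subseteq> SL I1 W1 <#>\<^bsub>QZ I\<^esub> SL I2 W2"
    and "\<Sigma>G = Sigma_group I G"
    and "I_tw = X ` {1..n} \<union> Y ` {1..m}"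
    and "W_tw = f1 - f2"
    and "G_tw = twist_group I_tw W_tw \<Sigma>G"
  shows "\<exists>tw_A \<in> module_iso complex_ring (state_space I W \<Sigma>G) (state_space I_tw W_tw G_tw).
           \<forall>d. tw_A ` bidegree_part I W \<Sigma>G d = bidegree_part I_tw W_tw G_tw d"
proof -
  interpret twist n m f1 f2 W1 W2 W W_tw I1 I2 I I_tw G \<Sigma>G G_tw
    by (rule twist.intro) (fact assms)+
  show ?thesis using tw_map_iso tw_map_bidegree_part by blast
qed

end
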